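(* Let $n\ge1$ and let $(X,S)$ have joint density $\frac{s^{n-1}}{\sigma^{n+1}}f\left(\frac{(x-\mu)^2+s^2}{\sigma^2}\right)$ on $\mathbb{R}\times(0,\infty)$, where $f:\mathbb{R}^+\to\mathbb{R}^+$ satisfies $f'<0$ and $tf'(t)/f(t)$ decreases in $t$ for $t>0$, and $\mu\ge0$, $\sigma>0$ are unknown. For estimating $\mu$ under the loss $\left|\frac{d-\mu}{\sigma}\right|^p$ with $p\in(0,1)$, the generalized Bayes estimator $\delta_{\pi_0}$ with respect to the prior $\pi_0(\mu,\sigma)=\sigma^{-1}1_{[0,\infty)}(\mu)1_{(0,\infty)}(\sigma)$ is minimax.
   Context: $f$ is a known differentiable function, normalized so that the given expression is a density. (This is the reduction to $(X,S=\|U\|)$ of $(X,U)\in\mathbb{R}\times\mathbb{R}^n$ with density proportional to $\sigma^{-(n+1)}f(((x-\mu)^2+\|u\|^2)/\sigma^2)$.) Parameter space $\Theta=\{\theta=(\mu,\sigma):\mu\ge0,\sigma>0\}$; risk $R(\theta,\delta)=E_\theta[\rho((\delta(X,S)-\mu)/\sigma)]$ with $\rho(t)=|t|^p$. It is assumed that a unique minimum risk equivariant (MRE) estimator with finite risk exists for the unconstrained problem; since $\rho$ is even it is $\delta_0(X,S)=X$. Its risk is constant, and it is known that $\delta_0$ is minimax over $\Theta$; hence "an estimator $\delta$ is minimax" means $R(\theta,\delta)\le R(\theta,\delta_0)$ for all $\theta\in\Theta$. The Bayes estimator $\delta_{\pi_0}$ is assumed to exist: $\delta_{\pi_0}(x,s)$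 is the (unique) minimizer in $d$ of $\int_0^\infty\int_0^\infty\rho\left(\frac{d-\mu}{\sigma}\right)\frac{s^{n-1}}{\sigma^{n+1}}f\left(\frac{(x-\mu)^2+s^2}{\sigma^2}\right)\frac1\sigma\,d\mu\,d\sigma$. It has the form $X+g_{\pi_0}(X/S)S$. *)

theory Defs
  imports "HOL-Probability.Probability"
begin

definition joint_density :: "nat \<Rightarrow> (real \<Rightarrow> real) \<Rightarrow> real \<Rightarrow> real \<Rightarrow> real \<times> real \<Rightarrow> real" where
  "joint_density n f \<mu> \<sigma> =
     (\<lambda>(x, s). s ^ (n - 1) / \<sigma> ^ (n + 1) * f (((x - \<mu>)\<^sup>2 + s\<^sup>2) / \<sigma>\<^sup>2))"

text \<open>The law of $(X,S)$ lives on $\<real> \<times> (0,\<infinity>)$, so the values of \<open>f\<close> outside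
  $(0,\<infinity>)$ and those of an estimator at $s \<le> 0$ play no role.\<close>

definition sample_space :: "(real \<times> real) set" where
  "sample_space = UNIV \<times> {0<..}"

definition model :: "nat \<Rightarrow> (real \<Rightarrow> real) \<Rightarrow> real \<Rightarrow> real \<Rightarrow> (real \<times> real) measure" where
  "model n f \<mu> \<sigma> =
     density (restrict_space lborel sample_space) (\<lambda>z. ennreal (joint_density n f \<mu> \<sigma> z))"

definition estimator :: "(real \<times> real \<Rightarrow> real) \<Rightarrow> bool" where
  "estimator \<delta> \<longleftrightarrow> \<delta> \<in> borel_measurable (restrict_space borel sample_space)"

definition loss :: "real \<Rightarrow> real \<Rightarrow> real \<Rightarrow> real \<Rightarrow> real" where
  "loss p \<mu> \<sigma> d = \<bar>(d - \<mu>) / \<sigma>\<bar> powr p"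

definition risk ::
  "nat \<Rightarrow> (real \<Rightarrow> real) \<Rightarrow> real \<Rightarrow> real \<Rightarrow> real \<Rightarrow> (real \<times> real \<Rightarrow> real) \<Rightarrow> ennreal" where
  "risk n f p \<mu> \<sigma> \<delta> = (\<integral>\<^sup>+ z. ennreal (loss p \<mu> \<sigma> (\<delta> z)) \<partial>model n f \<mu> \<sigma>)"

definition equivariant :: "(real \<times> real \<Rightarrow> real) \<Rightarrow> bool" where
  "equivariant \<delta> \<longleftrightarrow> estimator \<delta> \<and>
     (\<forall>a>0. \<forall>b x. \<forall>s>0. \<delta> (a * x + b, a * s) = a * \<delta> (x, s) + b)"

text \<open>Minimum risk equivariance refers to the unconstrained problem: \<open>\<mu>\<close> ranges over all
  reals here.\<close>

definition MRE :: "nat \<Rightarrow> (real \<Rightarrow> real) \<Rightarrow> real \<Rightarrow> (real \<times> real \<Rightarrow> real) \<Rightarrow> bool" where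
  "MRE n f p \<delta> \<longleftrightarrow> equivariant \<delta> \<and>
     (\<forall>\<delta>'. equivariant \<delta>' \<longrightarrow>
        (\<forall>\<mu> \<sigma>. \<sigma> > 0 \<longrightarrow> risk n f p \<mu> \<sigma> \<delta> \<le> risk n f p \<mu> \<sigma> \<delta>'))"

definition unique_MRE :: "nat \<Rightarrow> (real \<Rightarrow> real) \<Rightarrow> real \<Rightarrow> (real \<times> real \<Rightarrow> real) \<Rightarrow> bool" where
  "unique_MRE n f p \<delta> \<longleftrightarrow> MRE n f p \<delta> \<and>
     (\<forall>\<delta>'. MRE n f p \<delta>' \<longrightarrow> (\<forall>z\<in>sample_space. \<delta>' z = \<delta> z))"

definition \<pi>\<^sub>0 :: "real \<Rightarrow> real \<Rightarrow> real" where
  "\<pi>\<^sub>0 \<mu> \<sigma> = 1 / \<sigma> * indicator {0..} \<mu> * indicator {0<..} \<sigma>"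

text \<open>The unnormalized posterior expected loss of the decision \<open>d\<close> after observing \<open>z\<close>, for a
  possibly improper prior density \<open>\<pi>\<close>.\<close>

definition posterior_risk ::
  "nat \<Rightarrow> (real \<Rightarrow> real) \<Rightarrow> real \<Rightarrow> (real \<Rightarrow> real \<Rightarrow> real) \<Rightarrow> real \<times> real \<Rightarrow> real \<Rightarrow> ennreal" where
  "posterior_risk n f p \<pi> z d =
     (\<integral>\<^sup>+ \<sigma>. \<integral>\<^sup>+ \<mu>. ennreal (loss p \<mu> \<sigma> d * joint_density n f \<mu> \<sigma> z * \<pi> \<mu> \<sigma>)
        \<partial>lborel \<partial>lborel)"

text \<open>The strict inequality makes the decision the unique minimizer, and it forces the minimal
  posterior expected loss to be finite.\<close>

definition generalized_Bayes ::
  "nat \<Rightarrow> (real \<Rightarrow> real) \<Rightarrow> real \<Rightarrow> (real \<Rightarrow> real \<Rightarrow> real) \<Rightarrow> (real \<times> real \<Rightarrow> real) \<Rightarrow> bool" where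
  "generalized_Bayes n f p \<pi> \<delta> \<longleftrightarrow> estimator \<delta> \<and>
     (\<forall>z\<in>sample_space. \<forall>d. d \<noteq> \<delta> z \<longrightarrow>
        posterior_risk n f p \<pi> z (\<delta> z) < posterior_risk n f p \<pi> z d)"

text \<open>The minimum risk equivariant estimator \<open>\<delta>\<^sub>0\<close> has constant risk and is minimax over the
  constrained parameter space $\<mu> \<ge> 0$, $\<sigma> > 0$. An estimator is therefore minimax if and only
  if its risk is everywhere at most that of \<open>\<delta>\<^sub>0\<close>; this is taken as the meaning of minimaxity.\<close>

definition minimax ::
  "nat \<Rightarrow> (real \<Rightarrow> real) \<Rightarrow> real \<Rightarrow> (real \<times> real \<Rightarrow> real) \<Rightarrow> (real \<times> real \<Rightarrow> real) \<Rightarrow> bool" where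
  "minimax n f p \<delta>\<^sub>0 \<delta> \<longleftrightarrow> estimator \<delta> \<and>
     (\<forall>\<mu>\<ge>0. \<forall>\<sigma>>0. risk n f p \<mu> \<sigma> \<delta> \<le> risk n f p \<mu> \<sigma> \<delta>\<^sub>0)"

end

theory Submission
  imports Defs
begin

text \<open>Put \<open>w = (x - \<mu>) / s\<close>, \<open>v = s / \<sigma>\<close> and \<open>m = (n + p + 1) / 2\<close>. Integrating out the scale, the
  Bayes estimator is \<open>x + g (x / s) s\<close> where \<open>g t\<close> minimizes the integral of
  $|w + c|^p (1 + w^2)^{-m}$ over $w < t$, whatever \<open>f\<close> is. Uniqueness of the minimizers makes \<open>g\<close>
  nonnegative, nonincreasing and continuous.

  Kubokawa's integral expression of the risk difference writes the excess risk over \<open>x\<close> as an integral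
  over \<open>c > 0\<close> of the derivative of the loss at shift \<open>c\<close>, restricted to \<open>x / s < t\<close> with \<open>g t = c\<close>. After
  integrating over \<open>v\<close> this is the integral over \<open>w < t\<close> of
  $p\,{\rm sgn}(w + c)|w + c|^{p-1}(1 + w^2)^{-m}$ against a nonincreasing function
  of $(1 + w^2)/(t - w)^2$; without that factor it is at most 0 by the first-order condition for \<open>g t\<close>.
  In the coordinate \<open>y = 1 / (t - w)\<close> the quotient $(1 + w^2)/(t - w)^2$ is a quadratic polynomial,
  symmetric about its vertex, and since \<open>p < 1\<close> the singular weight is largest next to the sign
  change. Pairing \<open>y\<close> with its mirror image shows that the extra factor can only lower the integral.\<close>

section \<open>Real analysis: powers, cut-off indicators, the substitution
  \<open>w = t - 1 / x\<close>, reflections\<close>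

lemma abs_powr_add_le:
  fixes x y p :: real
  assumes "0 < p" "p \<le> 1"
  shows "\<bar>x + y\<bar> powr p \<le> \<bar>x\<bar> powr p + \<bar>y\<bar> powr p"
proof (cases "x + y = 0")
  case True
  then show ?thesis by simp
next
  case False
  define c where "c = \<bar>x\<bar> + \<bar>y\<bar>"
  have c: "c > 0" "\<bar>x + y\<bar> \<le> c" using False unfolding c_def by auto
  \<comment> \<open>After division by \<open>c\<close> both summands lie in the unit interval, where
    an exponent at most 1 can only increase a number.\<close>
  have unit: "r \<le> r powr p" if "0 \<le> r" "r \<le> 1" for r :: real
  proof (cases "r = 0")
    case False
    then have "r powr 1 \<le> r powr p" using that assms by (intro powr_mono') auto
    then show ?thesis using that by simp
  qed simp
  have "1 = \<bar>x\<bar> / c + \<bar>y\<bar> / c" using c unfolding c_def by (simp add: add_divide_distrib[symmetric])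
  also have "\<dots> \<le> (\<bar>x\<bar> / c) powr p + (\<bar>y\<bar> / c) powr p"
    by (intro add_mono unit) (use c in \<open>auto simp: c_def\<close>)
  also have "\<dots> = (\<bar>x\<bar> powr p + \<bar>y\<bar> powr p) / c powr p"
    using c by (simp add: powr_divide add_divide_distrib)
  finally have "c powr p \<le> \<bar>x\<bar> powr p + \<bar>y\<bar> powr p"
    using c by (simp add: field_simps)
  moreover have "\<bar>x + y\<bar> powr p \<le> c powr p" using c assms by (intro powr_mono2) auto
  ultimately show ?thesis by linarith
qed

lemma integrable_lborel_inverse_1_plus_square:
  "integrable lborel (\<lambda>x::real. inverse (1 + x\<^sup>2))"
  using integrable_inverse_1_plus_square by (simp add: set_integrable_def)

lemma integrable_powr_near_0:
  fixes a :: real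
  assumes "-1 < a"
  shows "integrable lborel (\<lambda>y. indicator {-1..1} y * \<bar>y\<bar> powr a)"
proof -
  have "((\<lambda>x. x powr a) has_integral (1 powr (a+1) / (a+1))) {0..1}"
    by (rule has_integral_powr_from_0) (use assms in auto)
  then have "(\<integral>\<^sup>+ y. ennreal (y powr a) * indicator {0..1} y \<partial>lborel) = ennreal (1 powr (a+1) / (a+1))"
    by (rule nn_integral_has_integral_lebesgue'[rotated]) auto
  then have *: "integrable lborel (\<lambda>y. indicator {0..1} y * y powr a)"
    by (intro integrableI_bounded) (auto simp: abs_mult mult.commute ennreal_mult' ennreal_indicator)
  have **: "integrable lborel (\<lambda>y. indicator {0..1} (-y) * (-y) powr a)"
    using lborel_integrable_real_affine[OF *, of "-1" 0] by simp
  show ?thesis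
    by (rule Bochner_Integration.integrable_bound[OF Bochner_Integration.integrable_add[OF * **]])
       (auto simp: indicator_def)
qed

lemma tendsto_indicator_lessThan:
  fixes s :: "nat \<Rightarrow> real"
  assumes s: "s \<longlonglongrightarrow> t" and "w \<noteq> t"
  shows "(\<lambda>i. indicator {..<s i} w :: real) \<longlonglongrightarrow> indicator {..<t} w"
proof (cases "w < t")
  case True
  have "\<forall>\<^sub>F i in sequentially. w < s i" by (rule order_tendstoD(1)[OF s True])
  then have "\<forall>\<^sub>F i in sequentially. indicator {..<s i} w = (1::real)" by eventually_elim simp
  then show ?thesis using True by (simp add: tendsto_eventually)
next
  case False
  then have "t < w" using \<open>w \<noteq> t\<close> by simp
  have "\<forall>\<^sub>F i in sequentially. s i < w" by (rule order_tendstoD(2)[OF s \<open>t < w\<close>])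
  then have "\<forall>\<^sub>F i in sequentially. indicator {..<s i} w = (0::real)" by eventually_elim simp
  then show ?thesis using False by (simp add: tendsto_eventually)
qed

lemma AE_tendsto_indicator_lessThan:
  fixes s :: "nat \<Rightarrow> real"
  assumes "s \<longlonglongrightarrow> t"
  shows "AE w in lborel. (\<lambda>i. indicator {..<s i} w :: real) \<longlonglongrightarrow> indicator {..<t} w"
  using AE_lborel_singleton[of t] by eventually_elim (rule tendsto_indicator_lessThan[OF assms])

text \<open>The map x -> t - 1 / x carries the positive half-line bijectively onto
  \<open>{..<t}\<close> with derivative 1 / x^2. The change of variables theorem speaks of absolute
  integrability for Lebesgue measure, hence the passages through the completion of
  \<open>lborel\<close>.\<close>

lemma integral_substitution_reciprocal:
  fixes h :: "real \<Rightarrow> real"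
  assumes [measurable]: "h \<in> borel_measurable borel"
    and int: "integrable lborel (\<lambda>w. indicator {..<t} w * h w)"
  shows "integrable lborel (\<lambda>x. indicator {0<..} x * (h (t - 1 / x) / x\<^sup>2))" (is ?int)
    and "(\<integral>w. indicator {..<t} w * h w \<partial>lborel)
      = (\<integral>x. indicator {0<..} x * (h (t - 1 / x) / x\<^sup>2) \<partial>lborel)" (is ?eq)
proof -
  let ?S = "{0<..} :: real set" and ?g = "\<lambda>x::real. t - 1 / x" and ?g' = "\<lambda>x::real. 1 / x\<^sup>2"
  have image: "?g ` ?S = {..<t}"
  proof safe
    fix w assume "w < t"
    then show "w \<in> ?g ` ?S" by (intro image_eqI[of _ _ "1 / (t - w)"]) auto
  qed auto
  have abs: "h absolutely_integrable_on {..<t}"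
    using int by (simp add: set_integrable_def integrable_completion)
  have 1: "(\<lambda>x. \<bar>?g' x\<bar> * h (?g x)) absolutely_integrable_on ?S \<and>
       integral ?S (\<lambda>x. \<bar>?g' x\<bar> * h (?g x)) = integral {..<t} h"
    unfolding image[symmetric]
  proof (rule has_absolute_integral_change_of_variables_1'[where S = ?S and g = ?g and g' = ?g' and f = h, THEN iffD2])
    show "(?g has_field_derivative ?g' x) (at x within ?S)" if "x \<in> ?S" for x
      using that by (auto intro!: derivative_eq_intros simp: power2_eq_square)
    show "inj_on ?g ?S" by (auto simp: inj_on_def)
  qed (use abs image in auto)
  then have "integrable lebesgue (\<lambda>x. indicator {0<..} x * (h (t - 1 / x) / x\<^sup>2))"
    by (simp add: set_integrable_def mult_ac)
  then show ?int by (subst (asm) integrable_completion) auto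
  have "(\<integral>w. indicator {..<t} w * h w \<partial>lborel) = integral {..<t} h"
    using set_lebesgue_integral_eq_integral(2)[OF abs]
    by (simp add: set_lebesgue_integral_def integral_completion)
  also have "\<dots> = (\<integral>x. indicator {0<..} x * (h (t - 1 / x) / x\<^sup>2) \<partial>lborel)"
    using set_lebesgue_integral_eq_integral(2)[OF conjunct1[OF 1]] conjunct2[OF 1]
    by (simp add: set_lebesgue_integral_def integral_completion mult_ac)
  finally show ?eq .
qed

lemma reflect_integral:
  fixes e :: "real \<Rightarrow> real"
  assumes "integrable lborel e"
  shows "integrable lborel (\<lambda>x. e x + e (2 * a - x))"
    and "(\<integral>x. e x + e (2 * a - x) \<partial>lborel) = 2 * (\<integral>x. e x \<partial>lborel)"
proof -
  have int: "integrable lborel (\<lambda>x. e (2 * a - x))"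
    using lborel_integrable_real_affine[OF assms, of "-1" "2 * a"] by simp
  then show "integrable lborel (\<lambda>x. e x + e (2 * a - x))" using assms by simp
  have "(\<integral>x. e (2 * a - x) \<partial>lborel) = (\<integral>x. e x \<partial>lborel)"
    by (subst (2) lborel_integral_real_affine[of "-1" _ "2 * a"]) auto
  then show "(\<integral>x. e x + e (2 * a - x) \<partial>lborel) = 2 * (\<integral>x. e x \<partial>lborel)"
    using int assms by simp
qed

text \<open>The symmetrized integrand is invariant under x -> 2 * a - x, so its sign to the left of
  \<open>a\<close> decides its sign everywhere, and its integral is twice that of
  \<open>e\<close>.\<close>

lemma reflect_integral_nonpos:
  fixes e :: "real \<Rightarrow> real"
  assumes int: "integrable lborel e" and le: "\<And>x. x \<le> a \<Longrightarrow> e x + e (2 * a - x) \<le> 0"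
  shows "(\<integral>x. e x \<partial>lborel) \<le> 0"
proof -
  have "0 \<le> - (e x + e (2 * a - x))" for x
    using le[of x] le[of "2 * a - x"] by (cases "x \<le> a") (auto simp: add.commute)
  then have "0 \<le> (\<integral>x. - (e x + e (2 * a - x)) \<partial>lborel)"
    by (rule Bochner_Integration.integral_nonneg)
  then show ?thesis
    unfolding Bochner_Integration.integral_minus using reflect_integral[OF int, of a] by simp
qed

section \<open>Power loss under a power-law weight\<close>

text \<open>The bound on \<open>m\<close> makes |w|^p times \<open>kern w\<close> decay at least
  like 1 / (1 + w^2). For m = (n + p + 1) / 2 it says n >= 1.\<close>

locale power_loss =
  fixes p m :: real
  assumes p_pos: "0 < p" and p_less_1: "p < 1" and m_ge: "1 + p / 2 \<le> m"
begin

text \<open>Up to scaling an unnormalized Student density: what density and loss leave behind in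
  \<open>w\<close> once the scale is integrated out.\<close>

definition kern :: "real \<Rightarrow> real" where
  "kern w = (1 + w\<^sup>2) powr (- m)"

text \<open>The derivative of (max y 0)^p, set to 0 at the kink. Splitting the derivative of the
  loss into \<open>up y\<close> and \<open>up (- y)\<close> keeps both parts nonnegative, so that
  Tonelli applies to each.\<close>

definition up :: "real \<Rightarrow> real" where
  "up y = (if y > 0 then p * y powr (p - 1) else 0)"

definition slope :: "real \<Rightarrow> real" where
  "slope y = up y - up (- y)"

definition J :: "real set \<Rightarrow> real \<Rightarrow> real" where
  "J A c = (\<integral>w. indicator A w * (\<bar>w + c\<bar> powr p * kern w) \<partial>lborel)"

text \<open>The formal derivative of \<open>J {..<t}\<close> at \<open>c\<close>. Since
  \<open>slope\<close> is unbounded near 0, the proofs integrate over the shift instead of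
  differentiating under the integral sign.\<close>

definition N :: "real \<Rightarrow> real \<Rightarrow> real" where
  "N t c = (\<integral>w. indicator {..<t} w * (slope (w + c) * kern w) \<partial>lborel)"

lemma measurable_kern [measurable]: "kern \<in> borel_measurable borel"
  unfolding kern_def by measurable

lemma measurable_up [measurable]: "up \<in> borel_measurable borel"
  unfolding up_def by measurable

lemma measurable_slope [measurable]: "slope \<in> borel_measurable borel"
  unfolding slope_def by measurable

lemma one_plus_square_pos: "0 < 1 + (w::real)\<^sup>2"
  by (simp add: add_pos_nonneg)

lemma kern_pos: "0 < kern w"
  using one_plus_square_pos[of w] by (simp add: kern_def)

lemma kern_nonneg: "0 \<le> kern w"
  using kern_pos[of w] by simp

lemma kern_minus: "kern (- w) = kern w"
  by (simp add: kern_def)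

lemma up_nonneg: "0 \<le> up y"
  using p_pos by (simp add: up_def)

lemma up_le_abs_slope: "s \<in> {1, -1} \<Longrightarrow> up (s * y) \<le> \<bar>slope y\<bar>"
  using up_nonneg[of y] up_nonneg[of "- y"] by (auto simp: slope_def up_def)

lemma abs_slope: "\<bar>slope y\<bar> = (if y = 0 then 0 else p * \<bar>y\<bar> powr (p - 1))"
  using p_pos by (auto simp: slope_def up_def abs_mult)

lemma powr_kern_le: "\<bar>w\<bar> powr p * kern w \<le> inverse (1 + w\<^sup>2)"
proof -
  have "\<bar>w\<bar> powr p = (w\<^sup>2) powr (p / 2)"
    by (metis abs_ge_zero power2_abs powr_half_sqrt powr_powr real_sqrt_abs mult.commute times_divide_eq_right mult_1 zero_le_power2 mult.left_neutral)
  also have "\<dots> \<le> (1 + w\<^sup>2) powr (p / 2)"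
    using p_pos by (intro powr_mono2) auto
  finally have "\<bar>w\<bar> powr p * kern w \<le> (1 + w\<^sup>2) powr (p / 2) * kern w"
    by (intro mult_right_mono kern_nonneg)
  also have "\<dots> = (1 + w\<^sup>2) powr (p / 2 - m)"
    by (simp add: kern_def powr_add[symmetric])
  also have "\<dots> \<le> (1 + w\<^sup>2) powr (- 1)"
    using m_ge by (intro powr_mono) auto
  also have "\<dots> = inverse (1 + w\<^sup>2)"
    using one_plus_square_pos[of w] by (simp add: powr_minus)
  finally show ?thesis .
qed

lemma kern_le: "kern w \<le> inverse (1 + w\<^sup>2)"
proof -
  have "kern w \<le> (1 + w\<^sup>2) powr (- 1)"
    unfolding kern_def using m_ge p_pos by (intro powr_mono) auto
  also have "\<dots> = inverse (1 + w\<^sup>2)"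
    using one_plus_square_pos[of w] by (simp add: powr_minus)
  finally show ?thesis .
qed

lemma integrable_kern: "integrable lborel kern"
  by (rule Bochner_Integration.integrable_bound[OF integrable_lborel_inverse_1_plus_square])
     (use kern_le kern_nonneg in \<open>auto intro: abs_of_nonneg[THEN ord_eq_le_trans] order_trans[OF _ abs_ge_self]\<close>)

lemma integrable_powr_kern_dom:
  "integrable lborel (\<lambda>w. \<bar>w\<bar> powr p * kern w + C * kern w)"
proof (intro Bochner_Integration.integrable_add integrable_mult_right integrable_kern)
  show "integrable lborel (\<lambda>w. \<bar>w\<bar> powr p * kern w)"
    by (rule Bochner_Integration.integrable_bound[OF integrable_lborel_inverse_1_plus_square])
       (use powr_kern_le kern_nonneg in \<open>auto simp: abs_mult abs_of_nonneg\<close>)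
qed

text \<open>Subadditivity separates the shift from \<open>w\<close>. The bound is uniform in
  \<open>A\<close> and in bounded shifts, so one dominating function serves a whole sequence in
  \<open>J_tendsto\<close>.\<close>

lemma powr_kern_dom:
  assumes "\<bar>c\<bar> powr p \<le> C"
  shows "\<bar>indicator A w * (\<bar>w + c\<bar> powr p * kern w)\<bar> \<le> \<bar>w\<bar> powr p * kern w + C * kern w"
proof -
  have "\<bar>indicator A w * (\<bar>w + c\<bar> powr p * kern w)\<bar> \<le> \<bar>w + c\<bar> powr p * kern w"
    using kern_nonneg[of w] by (auto simp: indicator_def)
  also have "\<dots> \<le> (\<bar>w\<bar> powr p + C) * kern w"
    using abs_powr_add_le[of p w c] p_pos p_less_1 assms
    by (intro mult_right_mono kern_nonneg) auto
  finally show ?thesis by (simp add: algebra_simps)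
qed

lemma integrable_J:
  assumes [measurable]: "A \<in> sets borel"
  shows "integrable lborel (\<lambda>w. indicator A w * (\<bar>w + c\<bar> powr p * kern w))"
  by (rule Bochner_Integration.integrable_bound[OF integrable_powr_kern_dom[of "\<bar>c\<bar> powr p"]])
     (use powr_kern_dom[of c "\<bar>c\<bar> powr p" A] in \<open>auto intro: order_trans[OF _ abs_ge_self]\<close>)

lemma nn_integral_J:
  assumes [measurable]: "A \<in> sets borel"
  shows "(\<integral>\<^sup>+w. ennreal (indicator A w * (\<bar>w + c\<bar> powr p * kern w)) \<partial>lborel) = ennreal (J A c)"
  unfolding J_def
  by (intro nn_integral_eq_integral integrable_J) (auto simp: kern_nonneg)

lemma J_nonneg: "0 \<le> J A c"
  unfolding J_def by (intro Bochner_Integration.integral_nonneg) (auto simp: kern_nonneg)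

text \<open>Dominated convergence in the domain and the shift at once; it will show that limits of
  minimizers are minimizers.\<close>

lemma J_tendsto:
  fixes A :: "nat \<Rightarrow> real set"
  assumes [measurable]: "\<And>i. A i \<in> sets borel" "B \<in> sets borel"
    and A: "AE w in lborel. (\<lambda>i. indicator (A i) w :: real) \<longlonglongrightarrow> indicator B w"
    and c: "c \<longlonglongrightarrow> d"
  shows "(\<lambda>i. J (A i) (c i)) \<longlonglongrightarrow> J B d"
proof -
  have "Bseq c" using c by (auto intro!: convergent_imp_Bseq convergentI)
  then obtain K where K: "K > 0" "\<And>i. \<bar>c i\<bar> \<le> K" by (auto simp: Bseq_def)
  have Kp: "\<bar>c i\<bar> powr p \<le> K powr p" for i
    using K p_pos by (intro powr_mono2) auto
  show ?thesis unfolding J_def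
  proof (rule integral_dominated_convergence[where w = "\<lambda>w. \<bar>w\<bar> powr p * kern w + K powr p * kern w"])
    show "AE w in lborel. (\<lambda>i. indicator (A i) w * (\<bar>w + c i\<bar> powr p * kern w))
       \<longlonglongrightarrow> indicator B w * (\<bar>w + d\<bar> powr p * kern w)"
      using A
    proof eventually_elim
      case (elim w)
      have "(\<lambda>i. \<bar>w + c i\<bar> powr p) \<longlonglongrightarrow> \<bar>w + d\<bar> powr p"
        using p_pos by (intro tendsto_powr' tendsto_rabs tendsto_add c tendsto_const) auto
      then show ?case by (intro tendsto_mult elim tendsto_const)
    qed
    show "AE w in lborel. norm (indicator (A i) w * (\<bar>w + c i\<bar> powr p * kern w))
         \<le> \<bar>w\<bar> powr p * kern w + K powr p * kern w" for i
      using powr_kern_dom[OF Kp] by auto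
  qed (use integrable_powr_kern_dom in \<open>auto\<close>)
qed

section \<open>The loss difference as an integral over the shift\<close>

lemma nn_integral_up:
  assumes "a \<le> b"
  shows "(\<integral>\<^sup>+y. ennreal (if a < y \<and> y < b then up y else 0) \<partial>lborel)
    = ennreal ((max b 0) powr p - (max a 0) powr p)"
proof (cases "b \<le> 0")
  case True
  then have "(\<lambda>y. ennreal (if a < y \<and> y < b then up y else 0)) = (\<lambda>_. 0)"
    by (auto simp: up_def)
  then show ?thesis using True assms by (simp add: max_def)
next
  case False
  define a' where "a' = max a 0"
  have a': "0 \<le> a'" "a' \<le> b" using False assms by (auto simp: a'_def)
  \<comment> \<open>If \<open>a'\<close> is 0, the derivative blows up at the left end because p <
    1; the interior form of the fundamental theorem asks only for continuity there.\<close>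
  have "(up has_integral (b powr p - a' powr p)) {a'..b}"
  proof (rule fundamental_theorem_of_calculus_interior)
    show "continuous_on {a'..b} (\<lambda>x. x powr p)"
      using a' p_pos by (intro continuous_on_powr' continuous_intros) auto
    show "((\<lambda>x. x powr p) has_vector_derivative up x) (at x)" if "x \<in> {a'<..<b}" for x
    proof -
      have "((\<lambda>x. x powr p) has_real_derivative p * x powr (p - 1)) (at x)"
        using that a' by (intro has_real_derivative_powr) auto
      then show ?thesis
        using that a' by (simp add: up_def has_real_derivative_iff_has_vector_derivative)
    qed
  qed (use a' in auto)
  then have "(\<integral>\<^sup>+y. ennreal (up y) * indicator {a'..b} y \<partial>lborel) = ennreal (b powr p - a' powr p)"
    by (intro nn_integral_has_integral_lebesgue') (auto simp: up_nonneg)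
  moreover have "AE y in lborel. ennreal (if a < y \<and> y < b then up y else 0) = ennreal (up y) * indicator {a'..b} y"
    using AE_lborel_singleton[of a'] AE_lborel_singleton[of b]
    by eventually_elim (auto simp: a'_def up_def indicator_def)
  then have "(\<integral>\<^sup>+y. ennreal (if a < y \<and> y < b then up y else 0) \<partial>lborel)
    = (\<integral>\<^sup>+y. ennreal (up y) * indicator {a'..b} y \<partial>lborel)"
    by (rule nn_integral_cong_AE)
  ultimately show ?thesis using False by (simp add: a'_def max_def)
qed

lemma nn_integral_up_shift:
  assumes "b \<le> a"
  shows "(\<integral>\<^sup>+c. ennreal (if b < c \<and> c < a then up (w + c) else 0) \<partial>lborel)
      = ennreal ((max (w + a) 0) powr p - (max (w + b) 0) powr p)" (is ?plus)
    and "(\<integral>\<^sup>+c. ennreal (if b < c \<and> c < a then up (- (w + c)) else 0) \<partial>lborel)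
      = ennreal ((max (- (w + b)) 0) powr p - (max (- (w + a)) 0) powr p)" (is ?minus)
proof -
  show ?plus
    using nn_integral_up[of "w + b" "w + a"] assms
      nn_integral_real_affine[of "\<lambda>y. ennreal (if w + b < y \<and> y < w + a then up y else 0)" 1 w]
    unfolding mult_1_left by simp
  have "(\<integral>\<^sup>+y. ennreal (if - (w + a) < y \<and> y < - (w + b) then up y else 0) \<partial>lborel) =
      (\<integral>\<^sup>+c. ennreal (if - (w + a) < - w + - 1 * c \<and> - w + - 1 * c < - (w + b) then up (- w + - 1 * c) else 0) \<partial>lborel)"
    by (subst nn_integral_real_affine[of _ "-1" "-w"]) auto
  also have "\<dots> = (\<integral>\<^sup>+c. ennreal (if b < c \<and> c < a then up (- (w + c)) else 0) \<partial>lborel)"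
    by (intro nn_integral_cong) auto
  finally show ?minus
    using nn_integral_up[of "- (w + a)" "- (w + b)"] assms by simp
qed

lemma abs_powr_eq: "\<bar>y\<bar> powr p = (max y 0) powr p + (max (- y) 0) powr p"
  by (auto simp: max_def)

text \<open>The first claim is |w + a|^p - |w + b|^p = integral of \<open>slope (w + c)\<close> over
  b < c < a, with negative parts moved across to avoid subtraction in \<open>ennreal\<close>. The
  second bounds the negative part by a loss, so that it can be cancelled when that loss has a finite
  integral.\<close>

lemma loss_difference_pointwise:
  assumes "b \<le> a"
  shows "ennreal (\<bar>w + a\<bar> powr p) + (\<integral>\<^sup>+c. ennreal (if b < c \<and> c < a then up (- (w + c)) else 0) \<partial>lborel)
      = ennreal (\<bar>w + b\<bar> powr p) + (\<integral>\<^sup>+c. ennreal (if b < c \<and> c < a then up (w + c) else 0) \<partial>lborel)"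
    (is ?eq)
    and "(\<integral>\<^sup>+c. ennreal (if b < c \<and> c < a then up (- (w + c)) else 0) \<partial>lborel) \<le> ennreal (\<bar>w + b\<bar> powr p)"
    (is ?le)
proof -
  have "(max (w + b) 0) powr p \<le> (max (w + a) 0) powr p"
    "(max (- (w + a)) 0) powr p \<le> (max (- (w + b)) 0) powr p"
    using assms p_pos by (auto intro!: powr_mono2)
  then show ?eq
    unfolding nn_integral_up_shift[OF assms]
    by (simp add: ennreal_plus[symmetric] abs_powr_eq[of "w + a"] abs_powr_eq[of "w + b"] del: ennreal_plus)
  show ?le
    unfolding nn_integral_up_shift[OF assms] 
    using powr_ge_zero[of "max (w + b) 0" p] powr_ge_zero[of "max (- (w + a)) 0" p]
    unfolding abs_powr_eq[of "w + b"] by (intro ennreal_leI) linarith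
qed

text \<open>Tonelli puts the shift \<open>c\<close> outside, so that positive and negative parts can
  be compared for each \<open>c\<close> separately. It serves twice: with constant shifts for the
  first-order condition, and with shifts 0 and \<open>g\<close> for the risks.\<close>

lemma loss_difference:
  assumes "sigma_finite_measure M"
    and [measurable]: "W \<in> borel_measurable M" "a \<in> borel_measurable M" "b \<in> borel_measurable M"
    and ba: "\<And>x. b x \<le> a x"
  shows "(\<integral>\<^sup>+x. ennreal (\<bar>W x + a x\<bar> powr p) \<partial>M)
        + (\<integral>\<^sup>+c. \<integral>\<^sup>+x. ennreal (if b x < c \<and> c < a x then up (- (W x + c)) else 0) \<partial>M \<partial>lborel)
      = (\<integral>\<^sup>+x. ennreal (\<bar>W x + b x\<bar> powr p) \<partial>M)
        + (\<integral>\<^sup>+c. \<integral>\<^sup>+x. ennreal (if b x < c \<and> c < a x then up (W x + c) else 0) \<partial>M \<partial>lborel)"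
      (is ?eq)
    and "(\<integral>\<^sup>+c. \<integral>\<^sup>+x. ennreal (if b x < c \<and> c < a x then up (- (W x + c)) else 0) \<partial>M \<partial>lborel)
      \<le> (\<integral>\<^sup>+x. ennreal (\<bar>W x + b x\<bar> powr p) \<partial>M)" (is ?le)
proof -
  interpret M: sigma_finite_measure M by fact
  interpret P: pair_sigma_finite lborel M ..
  \<comment> \<open>The free factor \<open>s\<close> stands for 1 and -1, which covers both parts at
    once.\<close>
  have swap: "(\<integral>\<^sup>+c. \<integral>\<^sup>+x. ennreal (if b x < c \<and> c < a x then up (s * (W x + c)) else 0) \<partial>M \<partial>lborel)
     = (\<integral>\<^sup>+x. \<integral>\<^sup>+c. ennreal (if b x < c \<and> c < a x then up (s * (W x + c)) else 0) \<partial>lborel \<partial>M)" for s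
    by (rule P.Fubini'[symmetric]) simp
  note swap_minus = swap[of "-1", unfolded mult_minus1]
  note swap_plus = swap[of 1, unfolded mult_1_left]
  show ?eq
    unfolding swap_minus swap_plus
    by (subst (1 2) nn_integral_add[symmetric]) (simp_all add: loss_difference_pointwise(1)[OF ba])
  show ?le
    unfolding swap_minus
    by (intro nn_integral_mono loss_difference_pointwise(2)[OF ba])
qed

section \<open>Integrability and continuity of \<open>N\<close>, and the first-order
  condition\<close>

lemma abs_slope_le: "\<bar>slope y\<bar> \<le> indicator {-1..1} y * \<bar>y\<bar> powr (p - 1) + 1"
proof (cases "\<bar>y\<bar> \<le> 1")
  case True
  have "p * \<bar>y\<bar> powr (p - 1) \<le> 1 * \<bar>y\<bar> powr (p - 1)"
    using p_less_1 by (intro mult_right_mono) auto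
  then show ?thesis using True by (auto simp: abs_slope indicator_def)
next
  case False
  then have "p * \<bar>y\<bar> powr (p - 1) \<le> 1 * \<bar>y\<bar> powr 0"
    using p_less_1 p_pos by (intro mult_mono powr_mono) auto
  then show ?thesis using False by (auto simp: abs_slope indicator_def)
qed

lemma integrable_slope_dom: "integrable lborel (\<lambda>y. \<bar>slope y\<bar> * inverse (1 + y\<^sup>2))"
proof (rule Bochner_Integration.integrable_bound)
  show "integrable lborel (\<lambda>y. indicator {-1..1} y * \<bar>y\<bar> powr (p - 1) + inverse (1 + y\<^sup>2))"
    using integrable_powr_near_0[of "p - 1"] p_pos
    by (intro Bochner_Integration.integrable_add integrable_lborel_inverse_1_plus_square) auto
  have "\<bar>slope y\<bar> * inverse (1 + y\<^sup>2) \<le> indicator {-1..1} y * \<bar>y\<bar> powr (p - 1) + inverse (1 + y\<^sup>2)" for y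
  proof -
    have i: "0 \<le> inverse (1 + y\<^sup>2)" "inverse (1 + y\<^sup>2) \<le> 1"
      by (auto simp: inverse_le_1_iff)
    have "\<bar>slope y\<bar> * inverse (1 + y\<^sup>2) \<le> (indicator {-1..1} y * \<bar>y\<bar> powr (p - 1) + 1) * inverse (1 + y\<^sup>2)"
      by (intro mult_right_mono abs_slope_le i)
    also have "\<dots> \<le> indicator {-1..1} y * \<bar>y\<bar> powr (p - 1) * 1 + inverse (1 + y\<^sup>2)"
      unfolding distrib_right by (intro add_mono mult_left_mono i) auto
    finally show ?thesis by simp
  qed
  then show "AE y in lborel. norm (\<bar>slope y\<bar> * inverse (1 + y\<^sup>2))
     \<le> norm (indicator {-1..1} y * \<bar>y\<bar> powr (p - 1) + inverse (1 + y\<^sup>2))"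
    by (auto intro!: AE_I2 order_trans[OF _ abs_ge_self])
qed simp

lemma kern_shift_le:
  assumes "\<bar>c\<bar> \<le> K"
  shows "kern (y - c) \<le> 2 * (1 + K\<^sup>2) * inverse (1 + y\<^sup>2)"
proof -
  have "c\<^sup>2 \<le> K\<^sup>2" using assms by (simp add: abs_le_square_iff[symmetric])
  have "1 + y\<^sup>2 \<le> 2 * (1 + c\<^sup>2) * (1 + (y - c)\<^sup>2)"
  proof -
    \<comment> \<open>This sum of nonnegative terms is exactly the difference of the two
      sides.\<close>
    have "0 \<le> (y - 2 * c)\<^sup>2 + 1 + 2 * c\<^sup>2 * (y - c)\<^sup>2" by (intro add_nonneg_nonneg) auto
    then show ?thesis by (simp add: power2_eq_square algebra_simps)
  qed
  also have "\<dots> \<le> 2 * (1 + K\<^sup>2) * (1 + (y - c)\<^sup>2)"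
    using \<open>c\<^sup>2 \<le> K\<^sup>2\<close> by (intro mult_right_mono) auto
  finally have "inverse (1 + (y - c)\<^sup>2) \<le> 2 * (1 + K\<^sup>2) * inverse (1 + y\<^sup>2)"
    using one_plus_square_pos[of y] one_plus_square_pos[of "y - c"] by (simp add: field_simps)
  then show ?thesis using kern_le[of "y - c"] by linarith
qed

lemma slope_kern_dom:
  assumes "\<bar>c\<bar> \<le> K"
  shows "\<bar>indicator A y * (slope y * kern (y - c))\<bar> \<le> 2 * (1 + K\<^sup>2) * (\<bar>slope y\<bar> * inverse (1 + y\<^sup>2))"
proof -
  have "\<bar>indicator A y * (slope y * kern (y - c))\<bar> \<le> \<bar>slope y\<bar> * kern (y - c)"
    using kern_nonneg[of "y - c"] by (auto simp: indicator_def abs_mult)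
  also have "\<dots> \<le> \<bar>slope y\<bar> * (2 * (1 + K\<^sup>2) * inverse (1 + y\<^sup>2))"
    by (intro mult_left_mono kern_shift_le assms) auto
  finally show ?thesis by (simp add: mult_ac)
qed

lemma integrable_N:
  assumes [measurable]: "A \<in> sets borel"
  shows "integrable lborel (\<lambda>w. indicator A w * (slope (w + c) * kern w))"
proof -
  have "integrable lborel (\<lambda>y. indicator A (y - c) * (slope y * kern (y - c)))"
  proof (rule Bochner_Integration.integrable_bound)
    show "integrable lborel (\<lambda>y. 2 * (1 + \<bar>c\<bar>\<^sup>2) * (\<bar>slope y\<bar> * inverse (1 + y\<^sup>2)))"
      by (intro integrable_mult_right integrable_slope_dom)
    show "AE y in lborel. norm (indicator A (y - c) * (slope y * kern (y - c)))
       \<le> norm (2 * (1 + \<bar>c\<bar>\<^sup>2) * (\<bar>slope y\<bar> * inverse (1 + y\<^sup>2)))"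
      using slope_kern_dom[of c "\<bar>c\<bar>" "{y. y - c \<in> A}"]
      by (auto intro!: AE_I2 order_trans[OF _ abs_ge_self] simp: indicator_def)
  qed simp
  from lborel_integrable_real_affine[OF this, of 1 c] show ?thesis
    by (simp add: algebra_simps)
qed

text \<open>Moves the singularity of \<open>slope\<close> from w = -c to the fixed point y = 0, so
  that one dominating function works for all shifts in a bounded range.\<close>

lemma N_shift: "N t c = (\<integral>y. indicator {..<t + c} y * (slope y * kern (y - c)) \<partial>lborel)"
proof -
  have "(\<integral>y. indicator {..<t + c} y * (slope y * kern (y - c)) \<partial>lborel)
    = (\<integral>w. indicator {..<t + c} (c + 1 * w) * (slope (c + 1 * w) * kern (c + 1 * w - c)) \<partial>lborel)"
    by (subst lborel_integral_real_affine[of 1 _ c]) auto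
  also have "\<dots> = N t c"
    unfolding N_def by (intro Bochner_Integration.integral_cong) (auto simp: indicator_def add.commute)
  finally show ?thesis ..
qed

lemma N_tendsto:
  fixes c :: "nat \<Rightarrow> real"
  assumes c: "c \<longlonglongrightarrow> d"
  shows "(\<lambda>i. N t (c i)) \<longlonglongrightarrow> N t d"
proof -
  have "Bseq c" using c by (auto intro!: convergent_imp_Bseq convergentI)
  then obtain K where K: "K > 0" "\<And>i. \<bar>c i\<bar> \<le> K" by (auto simp: Bseq_def)
  show ?thesis unfolding N_shift
  proof (rule integral_dominated_convergence[where w = "\<lambda>y. 2 * (1 + K\<^sup>2) * (\<bar>slope y\<bar> * inverse (1 + y\<^sup>2))"])
    show "AE y in lborel. (\<lambda>i. indicator {..<t + c i} y * (slope y * kern (y - c i)))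
       \<longlonglongrightarrow> indicator {..<t + d} y * (slope y * kern (y - d))"
      using AE_lborel_singleton[of "t + d"]
    proof eventually_elim
      case (elim y)
      have "(\<lambda>i. indicator {..<t + c i} y :: real) \<longlonglongrightarrow> indicator {..<t + d} y"
        by (intro tendsto_indicator_lessThan tendsto_add tendsto_const c elim)
      moreover have "(\<lambda>i. kern (y - c i)) \<longlonglongrightarrow> kern (y - d)"
        unfolding kern_def using one_plus_square_pos[of "y - d"]
        by (intro tendsto_intros c) auto
      ultimately show ?case by (intro tendsto_mult tendsto_const)
    qed
    show "AE y in lborel. norm (indicator {..<t + c i} y * (slope y * kern (y - c i)))
         \<le> 2 * (1 + K\<^sup>2) * (\<bar>slope y\<bar> * inverse (1 + y\<^sup>2))" for i
      using slope_kern_dom[OF K(2)] by auto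
  qed (use integrable_slope_dom in auto)
qed

text \<open>If \<open>N t c\<close> were positive, continuity would give N t x > e for all x in (c -
  d, c), and integrating over this interval would make the shift c - d better than \<open>c\<close>
  by at least e * d.\<close>

lemma first_order_condition:
  assumes min: "\<And>b. J {..<t} c \<le> J {..<t} b"
  shows "N t c \<le> 0"
proof (rule ccontr)
  assume "\<not> N t c \<le> 0"
  define e where "e = N t c / 2"
  have e: "e > 0" "e < N t c" using \<open>\<not> N t c \<le> 0\<close> by (auto simp: e_def)
  have "isCont (N t) c"
    unfolding continuous_at_sequentially using N_tendsto by (auto simp: o_def)
  then have "\<forall>\<^sub>F x in at c. e < N t x"
    using e(2) by (auto simp: isCont_def intro: order_tendstoD)
  then obtain d where d: "d > 0" "\<And>x. \<bar>x - c\<bar> < d \<Longrightarrow> e < N t x"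
    using e(2) by (force simp: eventually_at dist_real_def)
  define b where "b = c - d"
  define M where "M = density lborel (\<lambda>w. ennreal (indicator {..<t} w * kern w))"
  \<comment> \<open>\<open>U 1 x\<close> and \<open>U (-1) x\<close> integrate the positive and the
    negative part of the integrand of \<open>N t x\<close>; \<open>V\<close> integrates them over b
    < x < c.\<close>
  define U where "U s x = (\<integral>w. indicator {..<t} w * (up (s * (w + x)) * kern w) \<partial>lborel)" for s x
  define V where "V s = (\<integral>\<^sup>+x. \<integral>\<^sup>+w. ennreal (if b < x \<and> x < c then up (s * (w + x)) else 0) \<partial>M \<partial>lborel)" for s
  have iU: "integrable lborel (\<lambda>w. indicator {..<t} w * (up (s * (w + x)) * kern w))"
    if "s \<in> {1, -1}" for s x
    by (rule Bochner_Integration.integrable_bound[OF integrable_N[of "{..<t}" x]])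
       (use up_le_abs_slope[OF that] up_nonneg kern_nonneg in
         \<open>auto simp: abs_mult indicator_def abs_of_nonneg intro!: mult_right_mono\<close>)
  have U_nonneg: "0 \<le> U s x" for s x
    unfolding U_def by (intro Bochner_Integration.integral_nonneg) (auto simp: up_nonneg kern_nonneg)
  have inner: "(\<integral>\<^sup>+w. ennreal (if b < x \<and> x < c then up (s * (w + x)) else 0) \<partial>M)
      = ennreal (U s x) * indicator {b<..<c} x" if "s \<in> {1, -1}" for s x
  proof (cases "b < x \<and> x < c")
    case True
    have "(\<integral>\<^sup>+w. ennreal (up (s * (w + x))) \<partial>M)
       = (\<integral>\<^sup>+w. ennreal (indicator {..<t} w * (up (s * (w + x)) * kern w)) \<partial>lborel)"
      unfolding M_def
      by (subst nn_integral_density)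
         (auto simp: ennreal_mult'[symmetric] kern_nonneg up_nonneg mult_ac intro!: nn_integral_cong)
    also have "\<dots> = ennreal (U s x)"
      unfolding U_def by (intro nn_integral_eq_integral iU that) (auto simp: up_nonneg kern_nonneg)
    finally show ?thesis using True by simp
  next
    case False
    then have zero: "(\<lambda>w. ennreal (if b < x \<and> x < c then up (s * (w + x)) else 0)) = (\<lambda>_. 0)"
      by auto
    show ?thesis unfolding zero using False by (auto simp: indicator_def)
  qed
  have UN: "U 1 x - U (-1) x = N t x" for x
    unfolding U_def N_def
    by (subst Bochner_Integration.integral_diff[symmetric, OF iU iU])
       (auto simp: slope_def algebra_simps)
  have MJ: "(\<integral>\<^sup>+w. ennreal (\<bar>w + x\<bar> powr p) \<partial>M) = ennreal (J {..<t} x)" for x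
    unfolding M_def nn_integral_J[of "{..<t}", symmetric, simplified]
    by (subst nn_integral_density)
       (auto simp: ennreal_mult'[symmetric] kern_nonneg mult_ac intro!: nn_integral_cong)
  have sf: "sigma_finite_measure M"
    unfolding M_def by (subst sigma_finite_measure.sigma_finite_iff_density_finite[OF sigma_finite_lborel]) auto
  have [measurable_cong]: "sets M = sets borel" by (simp add: M_def)
  have "b \<le> c" using d(1) by (simp add: b_def)
  note diff = loss_difference[OF sf, of "\<lambda>w. w" "\<lambda>_. c" "\<lambda>_. b", OF _ _ _ this, unfolded MJ]
  have eq: "ennreal (J {..<t} c) + V (-1) = ennreal (J {..<t} b) + V 1"
    unfolding V_def mult_minus1 mult_1_left by (rule diff(1)) simp_all
  have le: "V (-1) \<le> ennreal (J {..<t} b)"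
    unfolding V_def mult_minus1 by (rule diff(2)) simp_all
  \<comment> \<open>By \<open>eq\<close> the right-hand side equals the value of
    \<open>J {..<t} b\<close> plus \<open>V 1\<close>, so this is the minimality of
    \<open>c\<close>.\<close>
  have "ennreal (J {..<t} c) + V 1 \<le> ennreal (J {..<t} c) + V (-1)"
    unfolding eq using min[of b] by (intro add_right_mono ennreal_leI)
  then have "V 1 \<le> V (-1)"
    by (simp add: ennreal_add_left_cancel_le)
  moreover have "V (-1) + ennreal (e * d) \<le> V 1"
  proof -
    have "ennreal (e * d) = (\<integral>\<^sup>+x. ennreal e * indicator {b<..<c} x \<partial>lborel)"
      using d(1) e(1) by (simp add: nn_integral_cmult b_def ennreal_mult')
    then have "V (-1) + ennreal (e * d) = (\<integral>\<^sup>+x. ennreal (U (-1) x) * indicator {b<..<c} x + ennreal e * indicator {b<..<c} x \<partial>lborel)"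
      unfolding V_def inner[of "-1", simplified]
      by (subst nn_integral_add) (auto simp: U_def)
    also have "\<dots> \<le> (\<integral>\<^sup>+x. ennreal (U 1 x) * indicator {b<..<c} x \<partial>lborel)"
    proof (intro nn_integral_mono)
      fix x
      have "U (-1) x + e \<le> U 1 x" if "b < x" "x < c"
        using UN[of x] d(2)[of x] that by (auto simp: b_def)
      then show "ennreal (U (-1) x) * indicator {b<..<c} x + ennreal e * indicator {b<..<c} x
        \<le> ennreal (U 1 x) * indicator {b<..<c} x"
        using U_nonneg e(1) by (auto simp: indicator_def ennreal_plus[symmetric] simp del: ennreal_plus intro!: ennreal_leI)
    qed
    also have "\<dots> = V 1" unfolding V_def inner[of 1, simplified] ..
    finally show ?thesis .
  qed
  ultimately have "V (-1) + ennreal (e * d) \<le> V (-1) + 0" by (simp add: order_trans)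
  moreover have "V (-1) \<noteq> \<top>" using le by (auto simp: top_unique)
  ultimately have "ennreal (e * d) \<le> 0"
    by (subst (asm) ennreal_add_left_cancel_le) auto
  then show False using e(1) d(1) by simp
qed

section \<open>Comparing shifts; sign, monotonicity and homogeneity of \<open>slope\<close>\<close>

lemma J_mono:
  assumes "A \<in> sets borel" and le: "\<And>w. w \<in> A \<Longrightarrow> \<bar>w + a\<bar> \<le> \<bar>w + b\<bar>"
  shows "J A a \<le> J A b"
  unfolding J_def
proof (intro integral_mono integrable_J assms)
  show "indicator A w * (\<bar>w + a\<bar> powr p * kern w) \<le> indicator A w * (\<bar>w + b\<bar> powr p * kern w)" for w
    using le[of w] p_pos
    by (cases "w \<in> A") (auto intro!: mult_right_mono powr_mono2 kern_nonneg)
qed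

lemma J_Un:
  assumes "A \<in> sets borel" "B \<in> sets borel" "A \<inter> B = {}"
  shows "J (A \<union> B) c = J A c + J B c"
proof -
  have "indicator (A \<union> B) w * x = indicator A w * x + indicator B w * x" for w x :: real
    using assms(3) by (auto simp: indicator_def)
  then show ?thesis unfolding J_def by (simp add: integrable_J assms)
qed

lemma J_minus: "J UNIV (- c) = J UNIV c"
proof -
  have "J UNIV (- c) = (\<integral>w. \<bar>- w + - c\<bar> powr p * kern (- w) \<partial>lborel)"
    unfolding J_def by (subst lborel_integral_real_affine[of "-1" _ 0]) auto
  also have "\<dots> = J UNIV c"
    unfolding J_def by (intro Bochner_Integration.integral_cong) (auto simp: kern_minus abs_minus_commute add.commute)
  finally show ?thesis .
qed

lemma slope_minus: "slope (- y) = - slope y"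
  by (simp add: slope_def)

lemma slope_nonneg: "0 \<le> y \<Longrightarrow> 0 \<le> slope y"
  using up_nonneg[of y] by (simp add: slope_def up_def)

lemma slope_nonpos: "y \<le> 0 \<Longrightarrow> slope y \<le> 0"
  using slope_nonneg[of "- y"] by (simp add: slope_minus)

lemma slope_pos: "0 < y \<Longrightarrow> 0 < slope y"
  using p_pos by (simp add: slope_def up_def)

text \<open>Concavity of y^p for p < 1. In the mirror pairing it makes the point nearer to the sign
  change carry the larger slope.\<close>

lemma slope_antimono: "0 < y \<Longrightarrow> y \<le> z \<Longrightarrow> slope z \<le> slope y"
  using p_pos p_less_1 by (auto simp: slope_def up_def intro!: mult_left_mono powr_mono2')

lemma slope_divide:
  assumes "0 < x"
  shows "slope (y / x) = slope y * x powr (1 - p)"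
proof -
  have "up (z / x) = up z * x powr (1 - p)" for z
    using assms powr_minus_divide[of x "p - 1"]
    by (auto simp: up_def powr_divide zero_less_divide_iff)
  from this[of y] this[of "- y"] show ?thesis by (simp add: slope_def left_diff_distrib)
qed

section \<open>The reflection argument\<close>

definition quad :: "real \<Rightarrow> real \<Rightarrow> real" where
  "quad t x = (1 + t\<^sup>2) * x\<^sup>2 - 2 * t * x + 1"

text \<open>The integrand of \<open>N t c\<close> after the substitution w = t - 1 / x, extended by
  0 so that reflections may leave the half-line.\<close>

definition recip_weight :: "real \<Rightarrow> real \<Rightarrow> real \<Rightarrow> real" where
  "recip_weight t c x =
     indicator {0<..} x * (slope ((t + c) * x - 1) * x powr (2 * m - 1 - p) * quad t x powr (- m))"

lemma quad_eq: "quad t x = x\<^sup>2 + (t * x - 1)\<^sup>2"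
  by (simp add: quad_def power2_eq_square algebra_simps)

lemma quad_reciprocal:
  assumes "w < t"
  shows "quad t (1 / (t - w)) = (1 + w\<^sup>2) / (t - w)\<^sup>2"
proof -
  have "t / (t - w) - 1 = w / (t - w)" using assms by (simp add: field_simps)
  then show ?thesis by (simp add: quad_eq power_divide add_divide_distrib)
qed

lemma slope_kern_reciprocal:
  assumes "0 < x"
  shows "slope (t - 1 / x + c) * kern (t - 1 / x) / x\<^sup>2 = recip_weight t c x"
proof -
  have 1: "t - 1 / x + c = ((t + c) * x - 1) / x" using assms by (simp add: field_simps)
  have 2: "1 + (t - 1 / x)\<^sup>2 = quad t x / x powr 2"
    using assms by (simp add: quad_eq field_simps power2_eq_square)
  have 3: "kern (t - 1 / x) = quad t x powr (- m) * x powr (2 * m)"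
  proof -
    have "kern (t - 1 / x) = quad t x powr (- m) / (x powr 2) powr (- m)"
      unfolding kern_def 2 by (rule powr_divide)
    also have "(x powr 2) powr (- m) = inverse (x powr (2 * m))"
      by (simp only: powr_powr mult_minus_right powr_minus)
    finally show ?thesis by (simp only: divide_inverse inverse_inverse_eq)
  qed
  \<comment> \<open>The exponents add up as 1 - p from the homogeneity of \<open>slope\<close>, 2 *
    m from \<open>kern\<close> and -2 from the Jacobian.\<close>
  have 4: "x powr (1 - p) * x powr (2 * m) / x\<^sup>2 = x powr (2 * m - 1 - p)"
    using assms by (simp add: powr_numeral[symmetric] powr_add[symmetric] powr_diff[symmetric] algebra_simps del: powr_numeral)
  show ?thesis
    unfolding 1 3 slope_divide[OF assms] recip_weight_def
    using assms by (simp add: 4[symmetric])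
qed

text \<open>Under the substitution the extra factor becomes a function of \<open>quad t x\<close> by
  \<open>quad_reciprocal\<close>. Its boundedness gives integrability by comparison with the
  integrand of \<open>N\<close>; the constant factor 1 gives back \<open>N\<close> itself.\<close>

lemma recip_integral:
  assumes [measurable]: "\<Phi> \<in> borel_measurable borel" and bound: "\<And>y. \<bar>\<Phi> y\<bar> \<le> K"
  shows "integrable lborel (\<lambda>w. indicator {..<t} w * (slope (w + c) * kern w * \<Phi> ((1 + w\<^sup>2) / (t - w)\<^sup>2)))"
      (is ?int1)
    and "integrable lborel (\<lambda>x. recip_weight t c x * \<Phi> (quad t x))" (is ?int2)
    and "(\<integral>w. indicator {..<t} w * (slope (w + c) * kern w * \<Phi> ((1 + w\<^sup>2) / (t - w)\<^sup>2)) \<partial>lborel)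
      = (\<integral>x. recip_weight t c x * \<Phi> (quad t x) \<partial>lborel)" (is ?eq)
proof -
  define h where "h w = slope (w + c) * kern w * \<Phi> ((1 + w\<^sup>2) / (t - w)\<^sup>2)" for w
  have [measurable]: "h \<in> borel_measurable borel" unfolding h_def by measurable
  have K: "\<bar>\<Phi> y\<bar> \<le> \<bar>K\<bar>" for y using bound[of y] by linarith
  show int: ?int1
  proof (rule Bochner_Integration.integrable_bound)
    show "integrable lborel (\<lambda>w. \<bar>K\<bar> * (indicator {..<t} w * (slope (w + c) * kern w)))"
      by (intro integrable_mult_right integrable_N) simp
    show "AE w in lborel. norm (indicator {..<t} w * (slope (w + c) * kern w * \<Phi> ((1 + w\<^sup>2) / (t - w)\<^sup>2)))
      \<le> norm (\<bar>K\<bar> * (indicator {..<t} w * (slope (w + c) * kern w)))"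
    proof (intro AE_I2)
      fix w
      have "\<bar>slope (w + c) * kern w\<bar> * \<bar>\<Phi> ((1 + w\<^sup>2) / (t - w)\<^sup>2)\<bar> \<le> \<bar>slope (w + c) * kern w\<bar> * \<bar>K\<bar>"
        by (intro mult_left_mono K) simp
      then show "norm (indicator {..<t} w * (slope (w + c) * kern w * \<Phi> ((1 + w\<^sup>2) / (t - w)\<^sup>2)))
        \<le> norm (\<bar>K\<bar> * (indicator {..<t} w * (slope (w + c) * kern w)))"
        by (simp add: abs_mult indicator_def mult_ac)
    qed
  qed simp
  have eq: "indicator {0<..} x * (h (t - 1 / x) / x\<^sup>2) = recip_weight t c x * \<Phi> (quad t x)" for x
  proof (cases "0 < x")
    case True
    have "(1 + (t - 1 / x)\<^sup>2) / (t - (t - 1 / x))\<^sup>2 = quad t x"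
      using quad_reciprocal[of "t - 1 / x" t] True by simp
    then have "h (t - 1 / x) / x\<^sup>2 = slope (t - 1 / x + c) * kern (t - 1 / x) / x\<^sup>2 * \<Phi> (quad t x)"
      by (simp add: h_def)
    then show ?thesis using True by (simp add: slope_kern_reciprocal)
  qed (simp add: recip_weight_def)
  show ?int2 ?eq
    using integral_substitution_reciprocal[of h t] int unfolding eq h_def[symmetric] by auto
qed

lemma N_recip:
  "integrable lborel (recip_weight t c)" "N t c = (\<integral>x. recip_weight t c x \<partial>lborel)"
  using recip_integral(2,3)[of "\<lambda>_. 1" 1 t c] by (auto simp: N_def)

text \<open>In the coordinate \<open>x = 1 / (t - w)\<close> the function \<open>quad t\<close> is symmetric about its vertex
  \<open>x\<^sub>0\<close>, and \<open>1 / (t + c)\<close> is the point where the slope changes sign.\<close>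

context
  fixes t c x x' x\<^sub>0 :: real
  assumes tc: "0 < t + c" and le_1: "t * c \<le> 1"
  defines "x\<^sub>0 \<equiv> t / (1 + t\<^sup>2)" and "x' \<equiv> 2 * x\<^sub>0 - x"
  assumes x_le: "x \<le> x\<^sub>0"
begin

text \<open>Clearing denominators turns this into t * c <= 1. The vertex lies at or to the left of
  the sign change.\<close>

lemma vertex_le: "x\<^sub>0 \<le> 1 / (t + c)"
  using tc le_1 one_plus_square_pos[of t] by (simp add: x\<^sub>0_def field_simps power2_eq_square)

lemma quad_reflect: "quad t x' = quad t x"
proof -
  have "(1 + t\<^sup>2) * x\<^sub>0 = t" using one_plus_square_pos[of t] by (simp add: x\<^sub>0_def)
  moreover have "quad t x' - quad t x = 4 * (x\<^sub>0 - x) * ((1 + t\<^sup>2) * x\<^sub>0 - t)"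
    by (simp add: quad_def x'_def power2_eq_square algebra_simps)
  ultimately show ?thesis by simp
qed

lemma quad_diff: "quad t y - quad t z = (1 + t\<^sup>2) * (y - z) * (y + z - 2 * x\<^sub>0)"
proof -
  have v: "(1 + t\<^sup>2) * x\<^sub>0 = t" using one_plus_square_pos[of t] by (simp add: x\<^sub>0_def)
  have "(1 + t\<^sup>2) * (y - z) * (y + z - 2 * x\<^sub>0) = (1 + t\<^sup>2) * (y\<^sup>2 - z\<^sup>2) - 2 * (y - z) * ((1 + t\<^sup>2) * x\<^sub>0)"
    by (simp add: power2_eq_square algebra_simps)
  also have "\<dots> = quad t y - quad t z" unfolding v by (simp add: quad_def power2_eq_square algebra_simps)
  finally show ?thesis ..
qed

lemma recip_weight_nonpos: "y \<le> 1 / (t + c) \<Longrightarrow> recip_weight t c y \<le> 0"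
  using tc unfolding recip_weight_def
  by (intro mult_nonneg_nonpos mult_nonpos_nonneg slope_nonpos) (auto simp: field_simps)

text \<open>By \<open>vertex_le\<close> the mirror point \<open>x'\<close> is at least as close to
  the sign change as \<open>x\<close>, so the slope there is at least as large in size. The power of
  \<open>x'\<close> is at least that of \<open>x\<close>, and \<open>quad t\<close> agrees at both.
  Hence the positive value at \<open>x'\<close> outweighs the negative one at \<open>x\<close>; for
  x <= 0 the weight at \<open>x\<close> is 0.\<close>

lemma recip_weight_reflect:
  assumes "1 / (t + c) < x'"
  shows "0 \<le> recip_weight t c x + recip_weight t c x'"
proof -
  have pos': "0 < x'" using assms tc by (meson divide_pos_pos less_trans zero_less_one)
  have y': "0 < (t + c) * x' - 1" using assms tc by (simp add: field_simps)
  show ?thesis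
  proof (cases "0 < x")
    case True
    have "x + x' \<le> 2 / (t + c)" using vertex_le by (simp add: x'_def)
    then have "(t + c) * (x + x') \<le> 2" using tc by (simp add: field_simps)
    then have le: "(t + c) * x' - 1 \<le> - ((t + c) * x - 1)" by (simp add: algebra_simps)
    have "slope (- ((t + c) * x - 1)) * x powr (2 * m - 1 - p) * quad t x powr (- m)
      \<le> slope ((t + c) * x' - 1) * x' powr (2 * m - 1 - p) * quad t x' powr (- m)"
      unfolding quad_reflect
    proof (intro mult_right_mono mult_mono slope_antimono y' le)
      show "x powr (2 * m - 1 - p) \<le> x' powr (2 * m - 1 - p)"
        using True x_le m_ge p_less_1 by (intro powr_mono2) (auto simp: x'_def)
      show "0 \<le> slope ((t + c) * x' - 1)" using y' by (intro slope_nonneg) simp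
    qed auto
    then show ?thesis using True pos' unfolding slope_minus by (simp add: recip_weight_def)
  next
    case False
    then show ?thesis using pos' y' by (simp add: recip_weight_def slope_nonneg)
  qed
qed

text \<open>\<open>D\<close> takes the same value at both points and factors out of the sum. If
  \<open>x'\<close> has not passed the sign change, both weights are nonpositive and D >= 0; if it
  has, then D <= 0 and the weights have a nonnegative sum.\<close>

lemma recip_weight_compare:
  assumes mono: "\<And>y z. y \<le> z \<Longrightarrow> \<Phi> z \<le> \<Phi> y"
  defines "D \<equiv> \<lambda>y. \<Phi> (quad t y) - \<Phi> (quad t (1 / (t + c)))"
  shows "recip_weight t c x * D x + recip_weight t c x' * D x' \<le> 0"
proof -
  have D: "D x' = D x" by (simp add: D_def quad_reflect)
  have x: "recip_weight t c x \<le> 0" using vertex_le x_le by (intro recip_weight_nonpos) auto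
  have diff: "quad t x' - quad t (1 / (t + c)) = (1 + t\<^sup>2) * (x' - 1 / (t + c)) * (1 / (t + c) - x)"
    by (simp add: quad_diff x'_def)
  show ?thesis
  proof (cases "x' \<le> 1 / (t + c)")
    case True
    have "quad t x' - quad t (1 / (t + c)) \<le> 0"
      unfolding diff using True vertex_le x_le
      by (intro mult_nonpos_nonneg mult_nonneg_nonpos) auto
    then have "0 \<le> D x" unfolding D[symmetric] using mono by (simp add: D_def)
    then show ?thesis
      unfolding D using x recip_weight_nonpos[OF True]
      by (intro add_nonpos_nonpos mult_nonpos_nonneg)
  next
    case False
    have "0 \<le> quad t x' - quad t (1 / (t + c))"
      unfolding diff using False vertex_le x_le by (intro mult_nonneg_nonneg) auto
    then have "D x \<le> 0" unfolding D[symmetric] using mono by (simp add: D_def)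
    moreover have "0 \<le> recip_weight t c x + recip_weight t c x'"
      using False by (intro recip_weight_reflect) simp
    ultimately show ?thesis
      unfolding D distrib_right[symmetric] by (intro mult_nonneg_nonpos)
  qed
qed

end

text \<open>For t * c = 1 the vertex coincides with the sign change, so
  \<open>recip_weight_reflect\<close> makes every mirror pair nonnegative.\<close>

lemma N_nonneg_boundary:
  assumes "0 < c"
  shows "0 \<le> N (1 / c) c"
proof -
  define t where "t = 1 / c"
  have tc: "0 < t + c" "t * c \<le> 1" and t: "0 < t" using assms by (auto simp: t_def add_pos_pos)
  have crossing: "1 / (t + c) = t / (1 + t\<^sup>2)"
    using assms by (simp add: t_def field_simps power2_eq_square)
  have "(\<integral>x. - recip_weight t c x \<partial>lborel) \<le> 0"
  proof (rule reflect_integral_nonpos[where a = "t / (1 + t\<^sup>2)"])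
    fix x assume x: "x \<le> t / (1 + t\<^sup>2)"
    have "0 \<le> recip_weight t c x + recip_weight t c (2 * (t / (1 + t\<^sup>2)) - x)"
    proof (cases "x = t / (1 + t\<^sup>2)")
      case True
      \<comment> \<open>The vertex is its own mirror image, and \<open>slope\<close> vanishes
        there.\<close>
      have "(t + c) * (t / (1 + t\<^sup>2)) = 1" unfolding crossing[symmetric] using tc by simp
      then show ?thesis unfolding True by (simp add: recip_weight_def slope_def)
    next
      case False
      then show ?thesis using x crossing by (intro recip_weight_reflect[OF tc x]) auto
    qed
    then show "- recip_weight t c x + - recip_weight t c (2 * (t / (1 + t\<^sup>2)) - x) \<le> 0" by simp
  qed (use N_recip(1) in auto)
  then show ?thesis using N_recip(2)[of t c] N_recip(1)[of t c] by (simp add: t_def)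
qed

text \<open>Enlarging \<open>{..<1 / c}\<close> to \<open>{..<t}\<close> adds only points with w + c
  > 0, where \<open>slope\<close> is positive. The contrapositive turns the first-order condition
  into t * c <= 1, the hypothesis of the pairing.\<close>

lemma N_pos:
  assumes c: "0 < c" and tc: "1 < t * c"
  shows "0 < N t c"
proof -
  let ?e = "\<lambda>w. indicator {1 / c..<t} w * (slope (w + c) * kern w)"
  have t: "1 / c < t" using c tc by (simp add: field_simps)
  have eq: "indicator {..<t} w * x = indicator {..<1 / c} w * x + indicator {1 / c..<t} w * x" for w x :: real
    using t by (auto simp: indicator_def)
  have split: "N t c = N (1 / c) c + (\<integral>w. ?e w \<partial>lborel)"
    unfolding N_def eq by (intro Bochner_Integration.integral_add integrable_N) auto
  have pos: "0 < slope (w + c) * kern w" if "1 / c \<le> w" for w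
  proof -
    have "0 < 1 / c" using c by simp
    then have "0 < w + c" using that c by linarith
    then show ?thesis by (intro mult_pos_pos slope_pos kern_pos)
  qed
  have nonneg: "0 \<le> ?e w" for w using pos[of w] by (auto simp: indicator_def)
  have "(\<integral>w. ?e w \<partial>lborel) \<noteq> 0"
  proof
    assume "(\<integral>w. ?e w \<partial>lborel) = 0"
    then have "AE w in lborel. ?e w = 0"
      using nonneg by (subst (asm) integral_nonneg_eq_0_iff_AE) (auto intro: integrable_N)
    then have "AE w in lborel. w \<notin> {1 / c..<t}"
    proof eventually_elim
      case (elim w)
      then show ?case using pos[of w] by (auto simp: indicator_def)
    qed
    then have "emeasure lborel {1 / c..<t} = 0"
      by (subst (asm) AE_iff_measurable[of "{1 / c..<t}"]) auto
    then show False using t by simp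
  qed
  moreover have "0 \<le> (\<integral>w. ?e w \<partial>lborel)" using nonneg by (rule Bochner_Integration.integral_nonneg)
  ultimately show ?thesis unfolding split using N_nonneg_boundary[OF c] by linarith
qed

text \<open>Subtract from \<open>\<Phi>\<close> its value \<open>z\<close> at the sign change. The
  remainder has a nonpositive integral by the mirror pairing, and the constant contributes N t c * z
  <= 0. If t + c <= 0, then \<open>slope\<close> is nonpositive on the whole domain.\<close>

lemma weighted_N_nonpos:
  assumes c: "0 < c" and N: "N t c \<le> 0"
    and [measurable]: "\<Phi> \<in> borel_measurable borel"
    and mono: "\<And>y z. y \<le> z \<Longrightarrow> \<Phi> z \<le> \<Phi> y"
    and bound: "\<And>y. 0 \<le> \<Phi> y" "\<And>y. \<Phi> y \<le> K"
  shows "(\<integral>w. indicator {..<t} w * (slope (w + c) * kern w * \<Phi> ((1 + w\<^sup>2) / (t - w)\<^sup>2)) \<partial>lborel) \<le> 0"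
proof (cases "0 < t + c")
  case False
  have "0 \<le> (\<integral>w. - (indicator {..<t} w * (slope (w + c) * kern w * \<Phi> ((1 + w\<^sup>2) / (t - w)\<^sup>2))) \<partial>lborel)"
  proof (rule Bochner_Integration.integral_nonneg)
    fix w
    show "0 \<le> - (indicator {..<t} w * (slope (w + c) * kern w * \<Phi> ((1 + w\<^sup>2) / (t - w)\<^sup>2)))"
    proof (cases "w < t")
      case True
      then have "slope (w + c) \<le> 0" using False by (intro slope_nonpos) simp
      then have "slope (w + c) * kern w * \<Phi> ((1 + w\<^sup>2) / (t - w)\<^sup>2) \<le> 0"
        using kern_nonneg bound by (intro mult_nonpos_nonneg)
      then show ?thesis using True by simp
    qed simp
  qed
  then show ?thesis by simp
next
  case tc: True
  have le_1: "t * c \<le> 1" using N_pos[OF c, of t] N by linarith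
  have b: "\<bar>\<Phi> y\<bar> \<le> K" for y using bound[of y] by simp
  define z where "z = \<Phi> (quad t (1 / (t + c)))"
  note int = recip_integral(2)[where \<Phi> = \<Phi>, OF _ b, of t c]
  have "(\<integral>x. recip_weight t c x * (\<Phi> (quad t x) - z) \<partial>lborel) \<le> 0"
  proof (rule reflect_integral_nonpos[where a = "t / (1 + t\<^sup>2)"])
    show "integrable lborel (\<lambda>x. recip_weight t c x * (\<Phi> (quad t x) - z))"
      using int N_recip(1)[of t c] by (simp add: right_diff_distrib)
  qed (use recip_weight_compare[OF tc le_1 _ mono] in \<open>auto simp: z_def\<close>)
  then have "(\<integral>x. recip_weight t c x * \<Phi> (quad t x) \<partial>lborel) \<le> N t c * z"
    using int N_recip[of t c] by (simp add: right_diff_distrib)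
  also have "\<dots> \<le> 0" using N bound(1) unfolding z_def by (intro mult_nonpos_nonneg)
  finally show ?thesis using recip_integral(3)[where \<Phi> = \<Phi>, OF _ b, of t c] by simp
qed

text \<open>The preceding inequality in the form that \<open>loss_difference\<close> calls for, with
  the two parts as separate \<open>ennreal\<close> integrals.\<close>

lemma weighted_up_le:
  assumes c: "0 < c" and N: "N t c \<le> 0"
    and [measurable]: "\<Phi> \<in> borel_measurable borel"
    and mono: "\<And>y z. y \<le> z \<Longrightarrow> \<Phi> z \<le> \<Phi> y"
    and bound: "\<And>y. 0 \<le> \<Phi> y" "\<And>y. \<Phi> y \<le> K"
  shows "(\<integral>\<^sup>+w. ennreal (indicator {..<t} w * (up (w + c) * kern w * \<Phi> ((1 + w\<^sup>2) / (t - w)\<^sup>2))) \<partial>lborel)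
    \<le> (\<integral>\<^sup>+w. ennreal (indicator {..<t} w * (up (- (w + c)) * kern w * \<Phi> ((1 + w\<^sup>2) / (t - w)\<^sup>2))) \<partial>lborel)"
proof -
  define e where "e s w = indicator {..<t} w * (up (s * (w + c)) * kern w * \<Phi> ((1 + w\<^sup>2) / (t - w)\<^sup>2))"
    for s w
  have b: "\<bar>\<Phi> y\<bar> \<le> K" for y using bound[of y] by simp
  have e_nonneg: "0 \<le> e s w" for s w by (simp add: e_def up_nonneg kern_nonneg bound)
  have int: "integrable lborel (e s)" if s: "s \<in> {1, -1}" for s
  proof (rule Bochner_Integration.integrable_bound[OF recip_integral(1)[where \<Phi> = \<Phi> and t = t and c = c, OF _ b]])
    show "AE w in lborel. norm (e s w)
      \<le> norm (indicator {..<t} w * (slope (w + c) * kern w * \<Phi> ((1 + w\<^sup>2) / (t - w)\<^sup>2)))"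
    proof (intro AE_I2)
      fix w
      have "indicator {..<t} w * (up (s * (w + c)) * kern w * \<Phi> ((1 + w\<^sup>2) / (t - w)\<^sup>2))
        \<le> indicator {..<t} w * (\<bar>slope (w + c)\<bar> * kern w * \<Phi> ((1 + w\<^sup>2) / (t - w)\<^sup>2))"
        by (intro mult_left_mono mult_right_mono up_le_abs_slope s kern_nonneg bound) auto
      then show "norm (e s w)
        \<le> norm (indicator {..<t} w * (slope (w + c) * kern w * \<Phi> ((1 + w\<^sup>2) / (t - w)\<^sup>2)))"
        using e_nonneg[of s w] bound kern_nonneg[of w] by (simp add: abs_mult) (simp add: e_def)
    qed
  qed (simp_all add: e_def[abs_def])
  have "(\<integral>w. e 1 w \<partial>lborel) - (\<integral>w. e (-1) w \<partial>lborel)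
    = (\<integral>w. indicator {..<t} w * (slope (w + c) * kern w * \<Phi> ((1 + w\<^sup>2) / (t - w)\<^sup>2)) \<partial>lborel)"
    by (subst Bochner_Integration.integral_diff[symmetric, OF int int])
       (auto simp: e_def slope_def algebra_simps)
  also have "\<dots> \<le> 0" by (rule weighted_N_nonpos[OF assms])
  finally have "(\<integral>\<^sup>+w. ennreal (e 1 w) \<partial>lborel) \<le> (\<integral>\<^sup>+w. ennreal (e (-1) w) \<partial>lborel)"
    by (subst (1 2) nn_integral_eq_integral) (auto simp: int e_nonneg intro!: ennreal_leI)
  then show ?thesis unfolding e_def mult_minus1 mult_1_left .
qed

text \<open>Allows the finiteness of \<open>tail 0\<close> to be read off from that of a
  product.\<close>

lemma J_UNIV_pos: "0 < J UNIV c"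
proof -
  have "J UNIV c \<noteq> 0"
  proof
    assume "J UNIV c = 0"
    then have "AE w in lborel. indicator UNIV w * (\<bar>w + c\<bar> powr p * kern w) = 0"
      unfolding J_def
      by (subst (asm) integral_nonneg_eq_0_iff_AE) (auto intro: integrable_J[of UNIV, simplified] simp: kern_nonneg)
    then have "AE w in lborel. w \<notin> {1 - c..2 - c}"
    proof eventually_elim
      case (elim w)
      then show ?case using kern_pos[of w] by auto
    qed
    then have "emeasure lborel {1 - c..2 - c} = 0"
      by (subst (asm) AE_iff_measurable[of "{1 - c..2 - c}"]) auto
    then show False by simp
  qed
  then show ?thesis using J_nonneg[of UNIV c] by simp
qed

end

section \<open>The shift of the Bayes estimator\<close>

text \<open>\<open>g t\<close> stands for the normalized shift of the Bayes estimator at x / s = t;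
  \<open>zero_min\<close> says that no shift at all is the unique best choice in the unconstrained
  problem.\<close>

locale bayes_shift = power_loss +
  fixes g :: "real \<Rightarrow> real"
  assumes g_min: "d \<noteq> g t \<Longrightarrow> J {..<t} (g t) < J {..<t} d"
    and zero_min: "d \<noteq> 0 \<Longrightarrow> J UNIV 0 < J UNIV d"
begin

lemma g_min_le: "J {..<t} (g t) \<le> J {..<t} d"
  using g_min[of d t] by (cases "d = g t") auto

text \<open>The distances |w + g s| and |w + g t| agree at w = -(g s + g t) / 2; to the right of it
  the smaller shift is better, to the left the larger one. If \<open>s\<close> lies to the right,
  passing from \<open>{..<s}\<close> to \<open>{..<t}\<close> favours \<open>g s\<close> further;
  otherwise \<open>g t\<close> is at least as good on all of \<open>{..<s}\<close>. Either way an
  optimality is violated.\<close>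

lemma g_antimono: "s \<le> t \<Longrightarrow> g t \<le> g s"
proof (rule ccontr)
  assume st: "s \<le> t" and "\<not> g t \<le> g s"
  then have lt: "g s < g t" by simp
  have split: "J {..<t} d = J {..<s} d + J {s..<t} d" for d
  proof -
    have "{..<s} \<union> {s..<t} = {..<t}" "{..<s} \<inter> {s..<t} = {}" using st by auto
    then show ?thesis using J_Un[of "{..<s}" "{s..<t}" d] by simp
  qed
  have 1: "J {..<s} (g s) < J {..<s} (g t)" and 2: "J {..<t} (g t) < J {..<t} (g s)"
    using g_min[of "g t" s] g_min[of "g s" t] lt by auto
  show False
  proof (cases "s \<ge> - (g s + g t) / 2")
    case True
    have "J {s..<t} (g s) \<le> J {s..<t} (g t)"
      using True lt by (intro J_mono) (auto simp: abs_le_iff abs_if field_simps)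
    then show False using 1 2 by (simp add: split)
  next
    case False
    have "J {..<s} (g t) \<le> J {..<s} (g s)"
      using False lt by (intro J_mono) (auto simp: abs_le_iff abs_if field_simps)
    then show False using 1 by simp
  qed
qed

text \<open>The argument of \<open>g_antimono\<close> with an infinite right end point, where
  \<open>zero_min\<close> makes 0 the optimal shift.\<close>

lemma g_nonneg: "0 \<le> g t"
proof (rule ccontr)
  assume "\<not> 0 \<le> g t"
  then have neg: "g t < 0" by simp
  have split: "J UNIV d = J {..<t} d + J {t..} d" for d
  proof -
    have "{..<t} \<union> {t..} = UNIV" "{..<t} \<inter> {t..} = {}" by auto
    then show ?thesis using J_Un[of "{..<t}" "{t..}" d] by simp
  qed
  have 1: "J {..<t} (g t) < J {..<t} 0" and 2: "J UNIV 0 < J UNIV (g t)"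
    using g_min[of 0 t] zero_min[of "g t"] neg by auto
  show False
  proof (cases "t \<ge> - g t / 2")
    case True
    have "J {t..} (g t) \<le> J {t..} 0"
      using True neg by (intro J_mono) (auto simp: abs_if)
    then show False using 1 2 by (simp add: split)
  next
    case False
    have "J {..<t} 0 \<le> J {..<t} (g t)"
      using False neg by (intro J_mono) (auto simp: abs_if)
    then show False using 1 by simp
  qed
qed

lemma measurable_g [measurable]: "g \<in> borel_measurable borel"
proof -
  have "mono (\<lambda>t. - g t)" by (auto intro!: monoI g_antimono)
  then have "(\<lambda>t. - g t) \<in> borel_measurable borel" by (rule borel_measurable_mono)
  then show ?thesis by simp
qed

text \<open>This is where uniqueness of the minimizer enters: it makes \<open>g\<close> continuous.\<close>

lemma g_limit:
  assumes s: "s \<longlonglongrightarrow> t" and gs: "(\<lambda>i. g (s i)) \<longlonglongrightarrow> L"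
  shows "g t = L"
proof (rule ccontr)
  assume "g t \<noteq> L"
  then have lt: "J {..<t} (g t) < J {..<t} L" by (intro g_min) auto
  have "(\<lambda>i. J {..<s i} (g (s i))) \<longlonglongrightarrow> J {..<t} L"
    "(\<lambda>i. J {..<s i} (g t)) \<longlonglongrightarrow> J {..<t} (g t)"
    by (intro J_tendsto AE_tendsto_indicator_lessThan s gs tendsto_const; simp)+
  then have "J {..<t} L \<le> J {..<t} (g t)"
    by (rule LIMSEQ_le) (auto intro!: exI[of _ 0] g_min_le)
  then show False using lt by simp
qed

text \<open>Monotonicity makes the set where \<open>g\<close> exceeds \<open>c\<close> a half-line,
  and continuity gives \<open>g\<close> the value \<open>c\<close> at its end. The event that the
  Bayes shift exceeds \<open>c\<close> thus becomes x / s < t, where \<open>c\<close> is optimal for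
  \<open>t\<close>.\<close>

lemma g_level:
  assumes c: "0 < c" and ex: "c < g T0"
  obtains t where "g t = c" "\<And>T. c < g T \<longleftrightarrow> T < t"
proof -
  define S where "S = {T. c < g T}"
  have down: "T \<in> S" if "T \<le> T'" "T' \<in> S" for T T'
    using g_antimono[OF that(1)] that(2) by (auto simp: S_def)
  have ne: "S \<noteq> {}" using ex by (auto simp: S_def)
  \<comment> \<open>Otherwise \<open>g\<close> stays above \<open>c\<close>, and its limit at
    infinity would minimize \<open>J UNIV\<close>, whose only minimizer is 0.\<close>
  have bdd: "bdd_above S"
  proof (rule ccontr)
    assume "\<not> bdd_above S"
    have all: "c < g T" for T
    proof -
      have "\<not> (\<forall>x\<in>S. x \<le> T)" using \<open>\<not> bdd_above S\<close> by (auto simp: bdd_above_def)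
      then obtain T' where "T' \<in> S" "T \<le> T'" by force
      then have "T \<in> S" using down by blast
      then show ?thesis by (simp add: S_def)
    qed
    have "decseq (\<lambda>i. g (real i))" by (auto simp: decseq_def intro: g_antimono)
    then obtain L where L: "(\<lambda>i. g (real i)) \<longlonglongrightarrow> L" "\<And>i. L \<le> g (real i)"
      using decseq_convergent[of "\<lambda>i. g (real i)" 0] g_nonneg by blast
    have "c \<le> L" using L(1) all by (intro LIMSEQ_le_const[OF L(1)]) (auto intro: less_imp_le)
    have ind: "AE w in lborel. (\<lambda>i. indicator {..<real i} w :: real) \<longlonglongrightarrow> indicator UNIV w"
    proof (intro AE_I2 tendsto_eventually)
      fix w :: real
      obtain k where "w < real k" using reals_Archimedean2 by blast
      show "\<forall>\<^sub>F i in sequentially. indicator {..<real i} w = (indicator UNIV w :: real)"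
        using eventually_ge_at_top[of k] by eventually_elim (use \<open>w < real k\<close> in auto)
    qed
    have "(\<lambda>i. J {..<real i} (g (real i))) \<longlonglongrightarrow> J UNIV L"
      "(\<lambda>i. J {..<real i} 0) \<longlonglongrightarrow> J UNIV 0"
      by (intro J_tendsto ind L tendsto_const; simp)+
    then have "J UNIV L \<le> J UNIV 0"
      by (rule LIMSEQ_le) (auto intro!: exI[of _ 0] g_min_le)
    then show False using zero_min[of L] \<open>c \<le> L\<close> c by auto
  qed
  define t where "t = Sup S"
  have below: "c < g T" if "T < t" for T
  proof -
    obtain T' where "T' \<in> S" "T < T'"
      using \<open>T < t\<close> unfolding t_def less_cSup_iff[OF ne bdd] by blast
    then have "T \<in> S" using down[of T T'] by simp
    then show ?thesis by (simp add: S_def)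
  qed
  have above: "g T \<le> c" if "t < T" for T
  proof -
    have "T \<notin> S" using cSup_upper[OF _ bdd, of T] that by (auto simp: t_def)
    then show ?thesis by (simp add: S_def)
  qed
  \<comment> \<open>Approaching \<open>t\<close> from the left gives c <= g t, from the right g t <=
    c.\<close>
  have zero: "(\<lambda>i. 1 / real (Suc i)) \<longlonglongrightarrow> 0"
    using LIMSEQ_inverse_real_of_nat by (simp add: inverse_eq_divide)
  have "decseq (\<lambda>i. g (t - 1 / real (Suc i)))"
    by (auto simp: decseq_def intro!: g_antimono divide_left_mono)
  then obtain L where L: "(\<lambda>i. g (t - 1 / real (Suc i))) \<longlonglongrightarrow> L"
    using decseq_convergent[of "\<lambda>i. g (t - 1 / real (Suc i))" 0] g_nonneg by blast
  have "g t = L"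
    using tendsto_diff[OF tendsto_const[of t] zero] by (intro g_limit[OF _ L]) auto
  moreover have "c \<le> L"
    by (rule LIMSEQ_le_const[OF L]) (auto intro!: exI[of _ 0] less_imp_le below)
  ultimately have 1: "c \<le> g t" by simp
  have above_Suc: "\<forall>i. g (t + 1 / real (Suc i)) \<le> c" by (auto intro: above)
  have inc: "incseq (\<lambda>i. g (t + 1 / real (Suc i)))"
    by (auto simp: incseq_def intro!: g_antimono divide_left_mono)
  then obtain L' where L': "(\<lambda>i. g (t + 1 / real (Suc i))) \<longlonglongrightarrow> L'"
    using incseq_convergent[of "\<lambda>i. g (t + 1 / real (Suc i))" c] above_Suc by blast
  have "g t = L'"
    using tendsto_add[OF tendsto_const[of t] zero] by (intro g_limit[OF _ L']) auto
  moreover have "L' \<le> c"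
    by (rule LIMSEQ_le_const2[OF L']) (auto intro!: exI[of _ 0] above)
  ultimately have "g t = c" using 1 by simp
  moreover have "c < g T \<longleftrightarrow> T < t" for T
    using below[of T] above[of T] \<open>g t = c\<close> by (cases T t rule: linorder_cases) auto
  ultimately show ?thesis by (rule that)
qed

end

section \<open>Risk and posterior risk\<close>

locale location_scale =
  fixes n :: nat and f :: "real \<Rightarrow> real" and p :: real
  assumes n_ge: "1 \<le> n" and p_pos': "0 < p" and p_less_1': "p < 1"
    and f_pos: "\<And>t. 0 < t \<Longrightarrow> 0 < f t" and f_cont: "continuous_on {0<..} f"
begin

sublocale power_loss p "(real n + p + 1) / 2"
  using n_ge p_pos' p_less_1' by unfold_locales auto

text \<open>\<open>f\<close> is controlled only at positive arguments; the cut-off makes it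
  measurable and nonnegative everywhere.\<close>

definition F :: "real \<Rightarrow> real" where
  "F t = (if 0 < t then f t else 0)"

text \<open>The radial integral beyond a cut-off. A negative cut-off has the same effect as
  0.\<close>

definition tail :: "real \<Rightarrow> ennreal" where
  "tail y = (\<integral>\<^sup>+z. ennreal (if 0 < z \<and> y < z then z powr (real n + p) * F (z\<^sup>2) else 0) \<partial>lborel)"

lemma F_nonneg: "0 \<le> F t"
  using f_pos[of t] by (auto simp: F_def less_imp_le)

lemma measurable_F [measurable]: "F \<in> borel_measurable borel"
proof -
  have "(\<lambda>t. indicator {0<..} t *\<^sub>R f t) \<in> borel_measurable borel"
    by (rule borel_measurable_continuous_on_indicator[OF _ f_cont]) simp
  moreover have "(\<lambda>t. indicator {0<..} t *\<^sub>R f t) = F" by (auto simp: F_def)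
  ultimately show ?thesis by simp
qed

lemma tail_antimono: "y \<le> z \<Longrightarrow> tail z \<le> tail y"
  unfolding tail_def by (intro nn_integral_mono ennreal_leI) (auto simp: F_nonneg)

text \<open>The substitution z = v * sqrt (1 + w^2) separates the variables. The power n + p and the
  Jacobian together leave the exponent -(n + p + 1) of sqrt (1 + w^2), which is
  \<open>kern w\<close>.\<close>

lemma nn_integral_radial:
  "(\<integral>\<^sup>+v. ennreal (if 0 < v \<and> a < v then v powr (real n + p) * F (v\<^sup>2 * (1 + w\<^sup>2)) else 0) \<partial>lborel)
    = ennreal (kern w) * tail (a * sqrt (1 + w\<^sup>2))"
proof -
  define r where "r = sqrt (1 + w\<^sup>2)"
  have r: "0 < r" "r\<^sup>2 = 1 + w\<^sup>2" using one_plus_square_pos[of w] by (auto simp: r_def)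
  have kern: "kern w = r powr - (real n + p) / r"
  proof -
    have "kern w = r powr (2 * - ((real n + p + 1) / 2))"
      unfolding kern_def r(2)[symmetric] powr_powr[symmetric] using r(1) by simp
    also have "\<dots> = r powr (- (real n + p) - 1)" by (rule arg_cong[where f = "(powr) r"]) (simp add: field_simps)
    finally show ?thesis using r(1) by (simp add: powr_diff)
  qed
  have "(\<integral>\<^sup>+v. ennreal (if 0 < v \<and> a < v then v powr (real n + p) * F (v\<^sup>2 * (1 + w\<^sup>2)) else 0) \<partial>lborel)
    = ennreal (1 / r) * (\<integral>\<^sup>+z. ennreal (if 0 < z / r \<and> a < z / r then (z / r) powr (real n + p) * F ((z / r)\<^sup>2 * (1 + w\<^sup>2)) else 0) \<partial>lborel)"
    using r(1) by (subst nn_integral_real_affine[of _ "1 / r" 0]) (simp_all cong: if_cong)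
  also have "\<dots> = ennreal (1 / r) * (\<integral>\<^sup>+z. ennreal (r powr - (real n + p)) * ennreal (if 0 < z \<and> a * r < z then z powr (real n + p) * F (z\<^sup>2) else 0) \<partial>lborel)"
  proof -
    have "ennreal (if 0 < z / r \<and> a < z / r then (z / r) powr (real n + p) * F ((z / r)\<^sup>2 * (1 + w\<^sup>2)) else 0)
      = ennreal (r powr - (real n + p)) * ennreal (if 0 < z \<and> a * r < z then z powr (real n + p) * F (z\<^sup>2) else 0)" for z
    proof (cases "0 < z \<and> a * r < z")
      case True
      have "(z / r) powr (real n + p) = r powr - (real n + p) * z powr (real n + p)"
        unfolding powr_divide powr_minus_divide by simp
      moreover have "(z / r)\<^sup>2 * (1 + w\<^sup>2) = z\<^sup>2" using r by (simp add: power_divide r(2)[symmetric])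
      moreover have "0 < z / r" "a < z / r" using True r(1) by (auto simp: field_simps)
      ultimately show ?thesis using True by (simp add: ennreal_mult'[symmetric] F_nonneg mult_ac)
    next
      case False
      then have "\<not> (0 < z / r \<and> a < z / r)" using r(1) by (auto simp: field_simps)
      then show ?thesis using False by auto
    qed
    then show ?thesis by simp
  qed
  also have "\<dots> = ennreal (1 / r) * (ennreal (r powr - (real n + p)) * tail (a * r))"
    unfolding tail_def by (subst nn_integral_cmult) auto
  also have "\<dots> = ennreal (kern w) * tail (a * r)"
    unfolding kern mult.assoc[symmetric] using r(1) by (subst ennreal_mult'[symmetric]) auto
  finally show ?thesis by (simp add: r_def)
qed

text \<open>In the coordinates w = (x - mu) / s and v = s / sigma the joint density is v^n times the
  value of \<open>F\<close>; the remaining v^p is the scale factor of the loss.\<close>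

definition weight :: "real \<Rightarrow> real \<Rightarrow> real" where
  "weight v w = (if 0 < v then v powr (real n + p) * F (v\<^sup>2 * (1 + w\<^sup>2)) else 0)"

lemma measurable_weight [measurable]: "(\<lambda>(v, w). weight v w) \<in> borel_measurable (borel \<Otimes>\<^sub>M borel)"
  unfolding weight_def by measurable

lemma weight_nonneg: "0 \<le> weight v w"
  by (simp add: weight_def F_nonneg)

lemma risk_eq_product:
  assumes \<sigma>: "0 < \<sigma>" and [measurable]: "g \<in> borel_measurable borel"
    and \<delta>: "\<And>x s. 0 < s \<Longrightarrow> \<delta> (x, s) = x + s * g (x / s)"
  shows "risk n f p \<mu> \<sigma> \<delta>
    = (\<integral>\<^sup>+s. \<integral>\<^sup>+x. ennreal (if 0 < s then s ^ (n - 1) / \<sigma> ^ (n + 1) * F (((x - \<mu>)\<^sup>2 + s\<^sup>2) / \<sigma>\<^sup>2)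
        * \<bar>(x + s * g (x / s) - \<mu>) / \<sigma>\<bar> powr p else 0) \<partial>lborel \<partial>lborel)"
proof -
  \<comment> \<open>\<open>h\<close> and \<open>l\<close> are measurable on the whole plane and
    agree with density and loss on \<open>sample_space\<close>, where alone the estimator is
    controlled.\<close>
  define h where "h = (\<lambda>(x, s). if 0 < s then s ^ (n - 1) / \<sigma> ^ (n + 1) * F (((x - \<mu>)\<^sup>2 + s\<^sup>2) / \<sigma>\<^sup>2) else 0)"
  define l where "l = (\<lambda>(x, s). \<bar>(x + s * g (x / s) - \<mu>) / \<sigma>\<bar> powr p)"
  have [measurable]: "h \<in> borel_measurable (borel \<Otimes>\<^sub>M borel)" "l \<in> borel_measurable (borel \<Otimes>\<^sub>M borel)"
    unfolding h_def l_def by measurable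
  have [measurable]: "h \<in> borel_measurable borel" "l \<in> borel_measurable borel"
    by (subst borel_prod[symmetric]; measurable)+
  have S [measurable]: "sample_space \<in> sets borel"
    unfolding sample_space_def by (intro borel_open open_Times) auto
  have joint: "joint_density n f \<mu> \<sigma> z = h z" if "z \<in> sample_space" for z
    using that \<sigma> by (auto simp: joint_density_def h_def F_def sample_space_def add_nonneg_pos zero_less_divide_iff)
  have loss: "loss p \<mu> \<sigma> (\<delta> z) = l z" if "z \<in> sample_space" for z
    using that \<delta> by (auto simp: loss_def l_def sample_space_def)
  have pointwise: "ennreal (h (x, s)) * ennreal (l (x, s)) = ennreal (if 0 < s then s ^ (n - 1) / \<sigma> ^ (n + 1) * F (((x - \<mu>)\<^sup>2 + s\<^sup>2) / \<sigma>\<^sup>2)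
        * \<bar>(x + s * g (x / s) - \<mu>) / \<sigma>\<bar> powr p else 0)" for x s
    using \<sigma> F_nonneg by (auto simp: h_def l_def ennreal_mult'[symmetric])
  let ?R = "restrict_space lborel sample_space"
  have mR: "h \<in> borel_measurable ?R" "l \<in> borel_measurable ?R"
    by (auto intro!: measurable_restrict_space1)
  have "risk n f p \<mu> \<sigma> \<delta> = (\<integral>\<^sup>+z. ennreal (loss p \<mu> \<sigma> (\<delta> z)) \<partial>density ?R (\<lambda>z. ennreal (joint_density n f \<mu> \<sigma> z)))"
    by (simp add: risk_def model_def)
  also have "density ?R (\<lambda>z. ennreal (joint_density n f \<mu> \<sigma> z)) = density ?R (\<lambda>z. ennreal (h z))"
  proof (rule density_cong)
    show "(\<lambda>z. ennreal (joint_density n f \<mu> \<sigma> z)) \<in> borel_measurable ?R"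
      by (subst measurable_cong[where g = "\<lambda>z. ennreal (h z)"]) (use mR in \<open>auto simp: joint space_restrict_space\<close>)
  qed (use mR in \<open>auto simp: joint space_restrict_space intro!: AE_I2\<close>)
  also have "(\<integral>\<^sup>+z. ennreal (loss p \<mu> \<sigma> (\<delta> z)) \<partial>density ?R (\<lambda>z. ennreal (h z)))
    = (\<integral>\<^sup>+z. ennreal (l z) \<partial>density ?R (\<lambda>z. ennreal (h z)))"
    by (intro nn_integral_cong) (auto simp: loss space_restrict_space)
  also have "\<dots> = (\<integral>\<^sup>+z. ennreal (h z) * ennreal (l z) \<partial>?R)"
    by (intro nn_integral_density) (use mR in auto)
  also have "\<dots> = (\<integral>\<^sup>+z. ennreal (h z) * ennreal (l z) * indicator sample_space z \<partial>lborel)"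
    by (subst nn_integral_restrict_space) auto
  also have "\<dots> = (\<integral>\<^sup>+z. ennreal (h z) * ennreal (l z) \<partial>(lborel \<Otimes>\<^sub>M lborel))"
    unfolding lborel_prod by (intro nn_integral_cong) (auto simp: h_def sample_space_def indicator_def split: if_splits)
  also have "\<dots> = (\<integral>\<^sup>+s. \<integral>\<^sup>+x. ennreal (h (x, s)) * ennreal (l (x, s)) \<partial>lborel \<partial>lborel)"
    by (rule lborel_pair.nn_integral_snd[symmetric]) simp
  also have "\<dots> = (\<integral>\<^sup>+s. \<integral>\<^sup>+x. ennreal (if 0 < s then s ^ (n - 1) / \<sigma> ^ (n + 1) * F (((x - \<mu>)\<^sup>2 + s\<^sup>2) / \<sigma>\<^sup>2)
        * \<bar>(x + s * g (x / s) - \<mu>) / \<sigma>\<bar> powr p else 0) \<partial>lborel \<partial>lborel)"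
    unfolding pointwise ..
  finally show ?thesis .
qed

text \<open>Substitute s = sigma * v and x = mu + sigma * v * w. Then x / s becomes w + mu / (sigma
  * v), and the parameters survive only through mu / sigma.\<close>

lemma risk_eq:
  assumes \<sigma>: "0 < \<sigma>" and [measurable]: "g \<in> borel_measurable borel"
    and \<delta>: "\<And>x s. 0 < s \<Longrightarrow> \<delta> (x, s) = x + s * g (x / s)"
  shows "risk n f p \<mu> \<sigma> \<delta>
    = (\<integral>\<^sup>+v. \<integral>\<^sup>+w. ennreal (weight v w) * ennreal (\<bar>w + g (w + \<mu> / \<sigma> / v)\<bar> powr p) \<partial>lborel \<partial>lborel)"
proof -
  define H where "H s x = (if 0 < s then s ^ (n - 1) / \<sigma> ^ (n + 1) * F (((x - \<mu>)\<^sup>2 + s\<^sup>2) / \<sigma>\<^sup>2)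
        * \<bar>(x + s * g (x / s) - \<mu>) / \<sigma>\<bar> powr p else 0)" for s x
  have [measurable]: "(\<lambda>(s, x). H s x) \<in> borel_measurable (borel \<Otimes>\<^sub>M borel)"
    unfolding H_def by measurable
  have H_nonneg: "0 \<le> H s x" for s x using \<sigma> F_nonneg by (simp add: H_def)
  have "risk n f p \<mu> \<sigma> \<delta> = (\<integral>\<^sup>+s. \<integral>\<^sup>+x. ennreal (H s x) \<partial>lborel \<partial>lborel)"
    unfolding H_def by (rule risk_eq_product[OF assms])
  also have "\<dots> = ennreal \<sigma> * (\<integral>\<^sup>+v. \<integral>\<^sup>+x. ennreal (H (\<sigma> * v) x) \<partial>lborel \<partial>lborel)"
    using \<sigma> by (subst nn_integral_real_affine[of _ \<sigma> 0]) auto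
  also have "\<dots> = (\<integral>\<^sup>+v. ennreal \<sigma> * (\<integral>\<^sup>+x. ennreal (H (\<sigma> * v) x) \<partial>lborel) \<partial>lborel)"
    by (rule nn_integral_cmult[symmetric]) simp
  also have "\<dots> = (\<integral>\<^sup>+v. \<integral>\<^sup>+w. ennreal (weight v w) * ennreal (\<bar>w + g (w + \<mu> / \<sigma> / v)\<bar> powr p) \<partial>lborel \<partial>lborel)"
  proof (intro nn_integral_cong)
    fix v :: real
    show "ennreal \<sigma> * (\<integral>\<^sup>+x. ennreal (H (\<sigma> * v) x) \<partial>lborel)
      = (\<integral>\<^sup>+w. ennreal (weight v w) * ennreal (\<bar>w + g (w + \<mu> / \<sigma> / v)\<bar> powr p) \<partial>lborel)"
    proof (cases "0 < v")
      case v: True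
      have "ennreal \<sigma> * (\<integral>\<^sup>+x. ennreal (H (\<sigma> * v) x) \<partial>lborel)
        = ennreal \<sigma> * (ennreal (\<sigma> * v) * (\<integral>\<^sup>+w. ennreal (H (\<sigma> * v) (\<mu> + (\<sigma> * v) * w)) \<partial>lborel))"
        using \<sigma> v by (subst nn_integral_real_affine[of _ "\<sigma> * v" \<mu>]) auto
      also have "\<dots> = (\<integral>\<^sup>+w. ennreal (\<sigma> * (\<sigma> * v)) * ennreal (H (\<sigma> * v) (\<mu> + (\<sigma> * v) * w)) \<partial>lborel)"
        using \<sigma> v by (subst nn_integral_cmult) (auto simp: ennreal_mult' mult.assoc)
      also have "\<dots> = (\<integral>\<^sup>+w. ennreal (weight v w) * ennreal (\<bar>w + g (w + \<mu> / \<sigma> / v)\<bar> powr p) \<partial>lborel)"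
      proof (intro nn_integral_cong)
        fix w
        have ratio: "(\<mu> + \<sigma> * v * w) / (\<sigma> * v) = w + \<mu> / \<sigma> / v"
          using \<sigma> v by (simp add: field_simps)
        have arg: "((\<mu> + \<sigma> * v * w - \<mu>)\<^sup>2 + (\<sigma> * v)\<^sup>2) / \<sigma>\<^sup>2 = v\<^sup>2 * (1 + w\<^sup>2)"
          using \<sigma> by (simp add: field_simps power2_eq_square)
        have "(\<mu> + \<sigma> * v * w + \<sigma> * v * y - \<mu>) / \<sigma> = v * (w + y)" for y
          using \<sigma> by (simp add: field_simps)
        then have lossv: "\<bar>(\<mu> + \<sigma> * v * w + \<sigma> * v * y - \<mu>) / \<sigma>\<bar> powr p = v powr p * \<bar>w + y\<bar> powr p" for y
          using v by (simp add: abs_mult powr_mult)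
        have jac: "\<sigma> * (\<sigma> * v) * ((\<sigma> * v) ^ (n - 1) / \<sigma> ^ (n + 1)) = v powr real n"
        proof -
          have "\<sigma> * (\<sigma> * v) * (\<sigma> * v) ^ (n - 1) = \<sigma> * (\<sigma> * v) ^ n"
            using n_ge by (cases n) auto
          then show ?thesis using \<sigma> v by (simp add: power_mult_distrib powr_realpow)
        qed
        have "\<sigma> * (\<sigma> * v) * H (\<sigma> * v) (\<mu> + (\<sigma> * v) * w)
          = (\<sigma> * (\<sigma> * v) * ((\<sigma> * v) ^ (n - 1) / \<sigma> ^ (n + 1))) * F (v\<^sup>2 * (1 + w\<^sup>2))
            * (v powr p * \<bar>w + g (w + \<mu> / \<sigma> / v)\<bar> powr p)"
          unfolding H_def ratio arg lossv using \<sigma> v by simp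
        also have "\<dots> = weight v w * \<bar>w + g (w + \<mu> / \<sigma> / v)\<bar> powr p"
          unfolding jac using v by (simp add: weight_def powr_add)
        finally show "ennreal (\<sigma> * (\<sigma> * v)) * ennreal (H (\<sigma> * v) (\<mu> + (\<sigma> * v) * w))
          = ennreal (weight v w) * ennreal (\<bar>w + g (w + \<mu> / \<sigma> / v)\<bar> powr p)"
          using \<sigma> v by (simp add: ennreal_mult'[symmetric] weight_nonneg H_nonneg)
      qed
      finally show ?thesis .
    next
      case False
      then have "\<not> 0 < \<sigma> * v" using \<sigma> by (simp add: zero_less_mult_iff)
      then show ?thesis using False by (simp add: H_def weight_def)
    qed
  qed
  finally show ?thesis .
qed

text \<open>With a constant shift the integral over \<open>v\<close> can be taken first and produces
  \<open>kern\<close>. Comparing such estimators thus reduces to \<open>J UNIV\<close>.\<close>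

lemma risk_affine:
  assumes \<sigma>: "0 < \<sigma>" and \<delta>: "\<And>x s. 0 < s \<Longrightarrow> \<delta> (x, s) = x + s * c"
  shows "risk n f p \<mu> \<sigma> \<delta> = tail 0 * ennreal (J UNIV c)"
proof -
  have "risk n f p \<mu> \<sigma> \<delta> = (\<integral>\<^sup>+v. \<integral>\<^sup>+w. ennreal (weight v w) * ennreal (\<bar>w + c\<bar> powr p) \<partial>lborel \<partial>lborel)"
    by (rule risk_eq[OF \<sigma> _ \<delta>]) auto
  also have "\<dots> = (\<integral>\<^sup>+w. \<integral>\<^sup>+v. ennreal (weight v w) * ennreal (\<bar>w + c\<bar> powr p) \<partial>lborel \<partial>lborel)"
    by (rule lborel_pair.Fubini'[symmetric]) simp
  also have "\<dots> = (\<integral>\<^sup>+w. tail 0 * ennreal (indicator UNIV w * (\<bar>w + c\<bar> powr p * kern w)) \<partial>lborel)"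
  proof (intro nn_integral_cong)
    fix w
    have "(\<integral>\<^sup>+v. ennreal (weight v w) * ennreal (\<bar>w + c\<bar> powr p) \<partial>lborel)
      = (\<integral>\<^sup>+v. ennreal (weight v w) \<partial>lborel) * ennreal (\<bar>w + c\<bar> powr p)"
      by (rule nn_integral_multc) simp
    also have "(\<integral>\<^sup>+v. ennreal (weight v w) \<partial>lborel) = ennreal (kern w) * tail 0"
      using nn_integral_radial[of 0 w] by (simp add: weight_def cong: if_cong)
    finally show "(\<integral>\<^sup>+v. ennreal (weight v w) * ennreal (\<bar>w + c\<bar> powr p) \<partial>lborel)
      = tail 0 * ennreal (indicator UNIV w * (\<bar>w + c\<bar> powr p * kern w))"
      by (simp add: ennreal_mult' kern_nonneg mult_ac)
  qed
  also have "\<dots> = tail 0 * ennreal (J UNIV c)"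
    by (subst nn_integral_cmult) (use nn_integral_J[of UNIV c] in auto)
  finally show ?thesis .
qed

text \<open>With mu = x - s * w the constraint mu >= 0 reads w <= x / s. Rescaling sigma by sqrt (1
  + w^2) splits off \<open>kern w\<close>, and the rest is a factor \<open>K\<close> that contains
  all dependence on \<open>f\<close> but involves neither \<open>x\<close> nor the decision.\<close>

lemma posterior_risk_eq:
  assumes s: "0 < s"
  obtains K where "\<And>x c. posterior_risk n f p \<pi>\<^sub>0 (x, s) (x + s * c) = K * ennreal (J {..<x / s} c)"
proof -
  define G where "G \<sigma> w = (if 0 < \<sigma> then (s / \<sigma>) powr p * (s ^ n / \<sigma> ^ (n + 2)) * F (s\<^sup>2 * (1 + w\<^sup>2) / \<sigma>\<^sup>2) else 0)" for \<sigma> w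
  have [measurable]: "(\<lambda>(\<sigma>, w). G \<sigma> w) \<in> borel_measurable (borel \<Otimes>\<^sub>M borel)"
    unfolding G_def by measurable
  have G_nonneg: "0 \<le> G \<sigma> w" for \<sigma> w using s F_nonneg by (simp add: G_def)
  define K where "K = (\<integral>\<^sup>+\<sigma>. ennreal (G \<sigma> 0) \<partial>lborel)"
  have G_int: "(\<integral>\<^sup>+\<sigma>. ennreal (G \<sigma> w) \<partial>lborel) = ennreal (kern w) * K" for w
  proof -
    define r where "r = sqrt (1 + w\<^sup>2)"
    have r: "0 < r" "r\<^sup>2 = 1 + w\<^sup>2" using one_plus_square_pos[of w] by (auto simp: r_def)
    have kern: "kern w = r * r powr - p / r ^ (n + 2)"
    proof -
      have "kern w = r powr (2 * - ((real n + p + 1) / 2))"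
        unfolding kern_def r(2)[symmetric] powr_powr[symmetric] using r(1) by simp
      also have "\<dots> = r powr (1 + - p - real (n + 2))" by (rule arg_cong[where f = "(powr) r"]) (simp add: field_simps)
      finally show ?thesis using r(1) by (simp only: powr_diff powr_add powr_one powr_realpow)
    qed
    have "(\<integral>\<^sup>+\<sigma>. ennreal (G \<sigma> w) \<partial>lborel) = ennreal r * (\<integral>\<^sup>+\<sigma>. ennreal (G (r * \<sigma>) w) \<partial>lborel)"
      using r(1) by (subst nn_integral_real_affine[of _ r 0]) auto
    also have "\<dots> = (\<integral>\<^sup>+\<sigma>. ennreal r * ennreal (G (r * \<sigma>) w) \<partial>lborel)"
      by (rule nn_integral_cmult[symmetric]) simp
    also have "\<dots> = (\<integral>\<^sup>+\<sigma>. ennreal (kern w) * ennreal (G \<sigma> 0) \<partial>lborel)"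
    proof (intro nn_integral_cong)
      fix \<sigma> :: real
      have "r * G (r * \<sigma>) w = kern w * G \<sigma> 0"
      proof (cases "0 < \<sigma>")
        case True
        have "s\<^sup>2 * (1 + w\<^sup>2) / (r * \<sigma>)\<^sup>2 = s\<^sup>2 / \<sigma>\<^sup>2"
          using r True by (simp add: power_mult_distrib r(2)[symmetric])
        moreover have "(s / (r * \<sigma>)) powr p = r powr - p * (s / \<sigma>) powr p"
          using s r True by (simp add: powr_divide powr_mult powr_minus field_simps)
        moreover have "0 < r * \<sigma>" using True r(1) by simp
        ultimately have "G (r * \<sigma>) w
            = r powr - p * (s / \<sigma>) powr p * (s ^ n / (r ^ (n + 2) * \<sigma> ^ (n + 2))) * F (s\<^sup>2 / \<sigma>\<^sup>2)"
          by (simp only: G_def power_mult_distrib if_True)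
        moreover have "G \<sigma> 0 = (s / \<sigma>) powr p * (s ^ n / \<sigma> ^ (n + 2)) * F (s\<^sup>2 / \<sigma>\<^sup>2)"
          using True by (simp add: G_def)
        ultimately show ?thesis unfolding kern by (simp only: times_divide_eq_right times_divide_eq_left divide_divide_eq_left mult_ac)
      next
        case False
        then have "\<not> 0 < r * \<sigma>" using r by (simp add: zero_less_mult_iff)
        then show ?thesis using False by (simp add: G_def)
      qed
      then show "ennreal r * ennreal (G (r * \<sigma>) w) = ennreal (kern w) * ennreal (G \<sigma> 0)"
        using r by (simp add: ennreal_mult'[symmetric] G_nonneg kern_nonneg)
    qed
    also have "\<dots> = ennreal (kern w) * K"
      unfolding K_def by (rule nn_integral_cmult) simp
    finally show ?thesis .
  qed
  have "posterior_risk n f p \<pi>\<^sub>0 (x, s) (x + s * c) = K * ennreal (J {..<x / s} c)" for x c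
  proof -
    let ?I = "indicator {..x / s} :: real \<Rightarrow> real"
    have inner: "(\<integral>\<^sup>+\<mu>. ennreal (loss p \<mu> \<sigma> (x + s * c) * joint_density n f \<mu> \<sigma> (x, s) * \<pi>\<^sub>0 \<mu> \<sigma>) \<partial>lborel)
      = (\<integral>\<^sup>+w. ennreal (G \<sigma> w) * ennreal (?I w * \<bar>w + c\<bar> powr p) \<partial>lborel)" for \<sigma>
    proof (cases "0 < \<sigma>")
      case True
      define H where "H \<mu> = \<bar>(x + s * c - \<mu>) / \<sigma>\<bar> powr p * (s ^ (n - 1) / \<sigma> ^ (n + 1) * F (((x - \<mu>)\<^sup>2 + s\<^sup>2) / \<sigma>\<^sup>2))
         * (1 / \<sigma> * indicator {0..} \<mu>)" for \<mu>
      have [measurable]: "H \<in> borel_measurable borel" unfolding H_def by measurable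
      have H_nonneg: "0 \<le> H \<mu>" for \<mu> using s True F_nonneg by (simp add: H_def)
      have "loss p \<mu> \<sigma> (x + s * c) * joint_density n f \<mu> \<sigma> (x, s) * \<pi>\<^sub>0 \<mu> \<sigma> = H \<mu>" for \<mu>
        using True s by (simp add: loss_def joint_density_def \<pi>\<^sub>0_def H_def F_def add_nonneg_pos)
      then have "(\<integral>\<^sup>+\<mu>. ennreal (loss p \<mu> \<sigma> (x + s * c) * joint_density n f \<mu> \<sigma> (x, s) * \<pi>\<^sub>0 \<mu> \<sigma>) \<partial>lborel)
        = (\<integral>\<^sup>+\<mu>. ennreal (H \<mu>) \<partial>lborel)" by simp
      also have "\<dots> = ennreal s * (\<integral>\<^sup>+w. ennreal (H (x - s * w)) \<partial>lborel)"
        using s by (subst nn_integral_real_affine[of _ "- s" x]) auto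
      also have "\<dots> = (\<integral>\<^sup>+w. ennreal s * ennreal (H (x - s * w)) \<partial>lborel)"
        by (rule nn_integral_cmult[symmetric]) simp
      also have "\<dots> = (\<integral>\<^sup>+w. ennreal (G \<sigma> w) * ennreal (?I w * \<bar>w + c\<bar> powr p) \<partial>lborel)"
      proof (intro nn_integral_cong)
        fix w
        have 1: "indicator {0..} (x - s * w) = ?I w" using s by (auto simp: indicator_def field_simps)
        have "(x + s * c - (x - s * w)) / \<sigma> = s / \<sigma> * (w + c)" using True by (simp add: field_simps)
        then have 2: "\<bar>(x + s * c - (x - s * w)) / \<sigma>\<bar> powr p = (s / \<sigma>) powr p * \<bar>w + c\<bar> powr p"
          using s True by (simp only: abs_mult powr_mult) simp
        have 3: "(x - (x - s * w))\<^sup>2 + s\<^sup>2 = s\<^sup>2 * (1 + w\<^sup>2)"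
          by (simp add: power2_eq_square algebra_simps)
        have 4: "s * (s ^ (n - 1) / \<sigma> ^ (n + 1) * y * (1 / \<sigma>)) = s ^ n / \<sigma> ^ (n + 2) * y" for y
          using n_ge True by (cases n) (auto simp: field_simps)
        have "s * H (x - s * w) = s * (s ^ (n - 1) / \<sigma> ^ (n + 1) * F (s\<^sup>2 * (1 + w\<^sup>2) / \<sigma>\<^sup>2) * (1 / \<sigma>))
           * ((s / \<sigma>) powr p * \<bar>w + c\<bar> powr p * ?I w)"
          unfolding H_def 1 2 3 by (simp add: mult_ac)
        also have "\<dots> = G \<sigma> w * (?I w * \<bar>w + c\<bar> powr p)"
          unfolding 4 using True by (simp add: G_def mult_ac)
        finally show "ennreal s * ennreal (H (x - s * w)) = ennreal (G \<sigma> w) * ennreal (?I w * \<bar>w + c\<bar> powr p)"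
          using s by (simp add: ennreal_mult'[symmetric] G_nonneg H_nonneg)
      qed
      finally show ?thesis .
    qed (simp add: \<pi>\<^sub>0_def G_def)
    have "posterior_risk n f p \<pi>\<^sub>0 (x, s) (x + s * c)
      = (\<integral>\<^sup>+\<sigma>. \<integral>\<^sup>+w. ennreal (G \<sigma> w) * ennreal (?I w * \<bar>w + c\<bar> powr p) \<partial>lborel \<partial>lborel)"
      unfolding posterior_risk_def inner ..
    also have "\<dots> = (\<integral>\<^sup>+w. \<integral>\<^sup>+\<sigma>. ennreal (G \<sigma> w) * ennreal (?I w * \<bar>w + c\<bar> powr p) \<partial>lborel \<partial>lborel)"
      by (rule lborel_pair.Fubini'[symmetric]) simp
    also have "\<dots> = (\<integral>\<^sup>+w. ennreal (kern w) * K * ennreal (?I w * \<bar>w + c\<bar> powr p) \<partial>lborel)"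
      unfolding G_int[symmetric] by (intro nn_integral_cong nn_integral_multc) simp
    \<comment> \<open>The closed half-line coming from mu >= 0 and the open one in \<open>J\<close>
      differ by a null set.\<close>
    also have "\<dots> = (\<integral>\<^sup>+w. K * ennreal (indicator {..<x / s} w * (\<bar>w + c\<bar> powr p * kern w)) \<partial>lborel)"
    proof (rule nn_integral_cong_AE)
      show "AE w in lborel. ennreal (kern w) * K * ennreal (?I w * \<bar>w + c\<bar> powr p)
        = K * ennreal (indicator {..<x / s} w * (\<bar>w + c\<bar> powr p * kern w))"
        using AE_lborel_singleton[of "x / s"]
        by eventually_elim (auto simp: indicator_def ennreal_mult' kern_nonneg mult_ac)
    qed
    also have "\<dots> = K * ennreal (J {..<x / s} c)"
      by (subst nn_integral_cmult) (use nn_integral_J[of "{..<x / s}" c] in auto)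
    finally show ?thesis .
  qed
  then show ?thesis by (rule that)
qed

section \<open>Comparison of risks\<close>

text \<open>\<open>\<kappa>\<close> is mu / sigma. By \<open>loss_difference\<close> with shifts
  \<open>g\<close> and 0 it suffices to compare the positive and the negative part at each level
  \<open>c\<close>.\<close>

lemma risk_integral_le:
  assumes shift: "bayes_shift p ((real n + p + 1) / 2) g" and \<kappa>: "0 \<le> \<kappa>" and fin: "tail 0 < \<infinity>"
  shows "(\<integral>\<^sup>+v. \<integral>\<^sup>+w. ennreal (weight v w) * ennreal (\<bar>w + g (w + \<kappa> / v)\<bar> powr p) \<partial>lborel \<partial>lborel)
    \<le> (\<integral>\<^sup>+v. \<integral>\<^sup>+w. ennreal (weight v w) * ennreal (\<bar>w + 0\<bar> powr p) \<partial>lborel \<partial>lborel)"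
    (is "?A \<le> ?B")
proof -
  interpret bayes_shift p "(real n + p + 1) / 2" g by fact
  define Q where "Q = density (lborel \<Otimes>\<^sub>M lborel) (\<lambda>(v, w). ennreal (weight v w))"
  have [measurable_cong]: "sets Q = sets (borel \<Otimes>\<^sub>M borel)"
    by (simp add: Q_def cong: sets_pair_measure_cong)
  have Q_int: "(\<integral>\<^sup>+z. h z \<partial>Q) = (\<integral>\<^sup>+v. \<integral>\<^sup>+w. ennreal (weight v w) * h (v, w) \<partial>lborel \<partial>lborel)"
    "(\<integral>\<^sup>+z. h z \<partial>Q) = (\<integral>\<^sup>+w. \<integral>\<^sup>+v. ennreal (weight v w) * h (v, w) \<partial>lborel \<partial>lborel)"
    if [measurable]: "h \<in> borel_measurable (borel \<Otimes>\<^sub>M borel)" for h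
  proof -
    have dens: "(\<integral>\<^sup>+z. h z \<partial>Q) = (\<integral>\<^sup>+z. (case z of (v, w) \<Rightarrow> ennreal (weight v w)) * h z \<partial>(lborel \<Otimes>\<^sub>M lborel))"
      unfolding Q_def by (rule nn_integral_density) auto
    show "(\<integral>\<^sup>+z. h z \<partial>Q) = (\<integral>\<^sup>+v. \<integral>\<^sup>+w. ennreal (weight v w) * h (v, w) \<partial>lborel \<partial>lborel)"
      unfolding dens by (subst lborel.nn_integral_fst[symmetric]) simp_all
    show "(\<integral>\<^sup>+z. h z \<partial>Q) = (\<integral>\<^sup>+w. \<integral>\<^sup>+v. ennreal (weight v w) * h (v, w) \<partial>lborel \<partial>lborel)"
      unfolding dens by (subst lborel_pair.nn_integral_snd[symmetric]) simp_all
  qed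
  define I where "I s c = (\<integral>\<^sup>+z. ennreal (if 0 < c \<and> c < g (snd z + \<kappa> / fst z) then up (s * (snd z + c)) else 0) \<partial>Q)"
    for s c
  have I_le: "I 1 c \<le> I (-1) c" for c
  proof (cases "0 < c \<and> (\<exists>T. c < g T)")
    case False
    then have zero: "(\<lambda>z. ennreal (if 0 < c \<and> c < g (snd z + \<kappa> / fst z) then up (1 * (snd z + c)) else 0)) = (\<lambda>_. 0)"
      by auto
    show ?thesis unfolding I_def zero by simp
  next
    case True
    then have c: "0 < c" by simp
    obtain t where t: "g t = c" "\<And>T. c < g T \<longleftrightarrow> T < t" using g_level[OF c] True by blast
    have N: "N t c \<le> 0" using g_min_le[of t] t(1) by (intro first_order_condition) simp
    \<comment> \<open>At level \<open>c\<close> the condition w + kappa / v < t reads v > kappa / (t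
      - w), so \<open>nn_integral_radial\<close> leaves \<open>kern w\<close> times a tail. By
      monotonicity of \<open>tail\<close> the result is a nonincreasing function of (1 + w^2) / (t -
      w)^2.\<close>
    define \<Phi> where "\<Phi> y = enn2real (tail (\<kappa> * sqrt y))" for y
    \<comment> \<open>Negative arguments are included because \<open>\<Phi>\<close> lives on all
      reals and \<open>sqrt\<close> is odd.\<close>
    have tail0: "tail y \<le> tail 0" for y
    proof (cases "0 \<le> y")
      case False
      have "tail y = tail 0" unfolding tail_def using False by (intro nn_integral_cong) auto
      then show ?thesis by simp
    qed (rule tail_antimono)
    have tail_fin: "tail y < \<infinity>" for y using tail0[of y] fin by (rule le_less_trans)
    have mono: "\<Phi> z \<le> \<Phi> y" if "y \<le> z" for y z
      unfolding \<Phi>_def using \<kappa> that tail_fin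
      by (intro enn2real_mono tail_antimono mult_left_mono) auto
    have meas: "\<Phi> \<in> borel_measurable borel"
    proof -
      have "mono (\<lambda>y. - \<Phi> y)" by (auto intro!: monoI mono)
      then have "(\<lambda>y. - \<Phi> y) \<in> borel_measurable borel" by (rule borel_measurable_mono)
      then show ?thesis by simp
    qed
    have bound: "\<Phi> y \<le> enn2real (tail 0)" for y
      unfolding \<Phi>_def using fin by (intro enn2real_mono tail0) simp
    have I_eq: "I s c = (\<integral>\<^sup>+w. ennreal (indicator {..<t} w * (up (s * (w + c)) * kern w * \<Phi> ((1 + w\<^sup>2) / (t - w)\<^sup>2))) \<partial>lborel)" for s
    proof -
      have "I s c = (\<integral>\<^sup>+w. \<integral>\<^sup>+v. ennreal (weight v w) * ennreal (if w + \<kappa> / v < t then up (s * (w + c)) else 0) \<partial>lborel \<partial>lborel)"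
        unfolding I_def t(2) using c by (subst Q_int(2)) (simp_all cong: if_cong)
      also have "\<dots> = (\<integral>\<^sup>+w. ennreal (indicator {..<t} w * (up (s * (w + c)) * kern w * \<Phi> ((1 + w\<^sup>2) / (t - w)\<^sup>2))) \<partial>lborel)"
      proof (intro nn_integral_cong)
        fix w
        show "(\<integral>\<^sup>+v. ennreal (weight v w) * ennreal (if w + \<kappa> / v < t then up (s * (w + c)) else 0) \<partial>lborel)
          = ennreal (indicator {..<t} w * (up (s * (w + c)) * kern w * \<Phi> ((1 + w\<^sup>2) / (t - w)\<^sup>2)))"
        proof (cases "w < t")
          case True
          let ?v = "\<lambda>v. if 0 < v \<and> \<kappa> / (t - w) < v then v powr (real n + p) * F (v\<^sup>2 * (1 + w\<^sup>2)) else 0"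
          have "ennreal (weight v w) * ennreal (if w + \<kappa> / v < t then up (s * (w + c)) else 0)
            = ennreal (up (s * (w + c))) * ennreal (?v v)" for v
          proof (cases "0 < v")
            case v: True
            have "w + \<kappa> / v < t \<longleftrightarrow> \<kappa> / (t - w) < v" using True v by (auto simp: field_simps)
            then show ?thesis using v by (simp add: weight_def mult.commute)
          qed (simp add: weight_def)
          then have "(\<integral>\<^sup>+v. ennreal (weight v w) * ennreal (if w + \<kappa> / v < t then up (s * (w + c)) else 0) \<partial>lborel)
            = ennreal (up (s * (w + c))) * (ennreal (kern w) * tail (\<kappa> / (t - w) * sqrt (1 + w\<^sup>2)))"
            unfolding nn_integral_radial[symmetric] by (simp add: nn_integral_cmult)
          also have "\<kappa> / (t - w) * sqrt (1 + w\<^sup>2) = \<kappa> * sqrt ((1 + w\<^sup>2) / (t - w)\<^sup>2)"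
            using True by (simp add: real_sqrt_divide)
          also have "tail \<dots> = ennreal (\<Phi> ((1 + w\<^sup>2) / (t - w)\<^sup>2))"
            unfolding \<Phi>_def using tail_fin by simp
          finally show ?thesis
            using True by (simp add: ennreal_mult' up_nonneg kern_nonneg mult_ac)
        next
          case False
          \<comment> \<open>For w >= t no positive \<open>v\<close> qualifies, because kappa >= 0;
            this is where the constraint mu >= 0 enters.\<close>
          have "ennreal (weight v w) * ennreal (if w + \<kappa> / v < t then up (s * (w + c)) else 0) = 0" for v
          proof (cases "0 < v")
            case v: True
            then have "0 \<le> \<kappa> / v" using \<kappa> by simp
            then have "\<not> w + \<kappa> / v < t" using False by linarith
            then show ?thesis by simp
          qed (simp add: weight_def)
          then show ?thesis using False by (simp only: nn_integral_const) simp
        qed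
      qed
      finally show ?thesis .
    qed
    show ?thesis
      unfolding I_eq mult_minus1 mult_1_left
      by (rule weighted_up_le[OF c N meas mono _ bound]) (simp_all add: \<Phi>_def)
  qed
  have sf: "sigma_finite_measure Q"
    unfolding Q_def
    by (subst sigma_finite_measure.sigma_finite_iff_density_finite)
       (auto intro: lborel_pair.sigma_finite_measure_axioms)
  note diff = loss_difference[OF sf, of snd "\<lambda>z. g (snd z + \<kappa> / fst z)" "\<lambda>_. 0"]
  have R: "?A = (\<integral>\<^sup>+z. ennreal (\<bar>snd z + g (snd z + \<kappa> / fst z)\<bar> powr p) \<partial>Q)"
    "?B = (\<integral>\<^sup>+z. ennreal (\<bar>snd z + 0\<bar> powr p) \<partial>Q)"
    by (subst Q_int(1); simp)+
  have I: "(\<integral>\<^sup>+c. I 1 c \<partial>lborel) \<le> (\<integral>\<^sup>+c. I (-1) c \<partial>lborel)"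
    by (intro nn_integral_mono I_le)
  have eq: "?A + (\<integral>\<^sup>+c. I (-1) c \<partial>lborel) = ?B + (\<integral>\<^sup>+c. I 1 c \<partial>lborel)"
    unfolding R I_def mult_minus1 mult_1_left by (rule diff(1)) (auto simp: g_nonneg)
  have le: "(\<integral>\<^sup>+c. I (-1) c \<partial>lborel) \<le> ?B"
    unfolding R I_def mult_minus1 mult_1_left by (rule diff(2)) (auto simp: g_nonneg)
  \<comment> \<open>The negative part is at most \<open>?B\<close>, so it can be cancelled when
    \<open>?B\<close> is finite; otherwise the claim is trivial.\<close>
  show ?thesis
  proof (cases "?B = \<infinity>")
    case False
    then have "(\<integral>\<^sup>+c. I (-1) c \<partial>lborel) \<noteq> \<infinity>" using le by (auto simp: top_unique)
    moreover have "?A + (\<integral>\<^sup>+c. I (-1) c \<partial>lborel) \<le> ?B + (\<integral>\<^sup>+c. I (-1) c \<partial>lborel)"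
      unfolding eq by (intro add_left_mono I)
    ultimately show ?thesis
      unfolding add.commute[of _ "\<integral>\<^sup>+c. I (-1) c \<partial>lborel"] by (simp add: ennreal_add_left_cancel_le)
  qed simp
qed

section \<open>The form of the minimum risk equivariant and the Bayes estimator\<close>

lemma equivariant_affine: "equivariant (\<lambda>(x, s). x + s * c)"
proof -
  have "(\<lambda>(x, s). x + s * c) \<in> borel_measurable (borel :: (real \<times> real) measure)"
    by (subst borel_prod[symmetric]) measurable
  then show ?thesis
    by (auto simp: equivariant_def estimator_def algebra_simps intro: measurable_restrict_space1)
qed

text \<open>Equivariance forces the form x + s * c. Since \<open>J UNIV\<close> is even, the shift
  -c is equally good, and uniqueness gives c = 0; the same uniqueness makes 0 a strict
  minimizer.\<close>

lemma unique_MRE_eq: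
  assumes mre: "unique_MRE n f p \<delta>"
  shows "0 < s \<Longrightarrow> \<delta> (x, s) = x" and "d \<noteq> 0 \<Longrightarrow> J UNIV 0 < J UNIV d"
proof -
  define c where "c = \<delta> (0, 1)"
  have MRE: "MRE n f p \<delta>" and eqv: "equivariant \<delta>" using mre by (auto simp: unique_MRE_def MRE_def)
  have form: "\<delta> (x, s) = x + s * c" if "0 < s" for x s
  proof -
    have "\<delta> (s * 0 + x, s * 1) = s * \<delta> (0, 1) + x"
      using eqv that unfolding equivariant_def by (metis zero_less_one)
    then show ?thesis by (simp add: c_def)
  qed
  have unique: "d = c" if "J UNIV d \<le> J UNIV c" for d
  proof -
    have "MRE n f p (\<lambda>(x, s). x + s * d)"
      unfolding MRE_def
    proof (intro conjI allI impI equivariant_affine)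
      fix \<delta>' and \<mu> \<sigma> :: real
      assume "equivariant \<delta>'" "0 < \<sigma>"
      have "risk n f p \<mu> \<sigma> (\<lambda>(x, s). x + s * d) = tail 0 * ennreal (J UNIV d)"
        by (rule risk_affine) (use \<open>0 < \<sigma>\<close> in auto)
      also have "\<dots> \<le> tail 0 * ennreal (J UNIV c)" using that by (intro mult_left_mono ennreal_leI) auto
      also have "\<dots> = risk n f p \<mu> \<sigma> \<delta>" by (rule risk_affine[symmetric]) (use \<open>0 < \<sigma>\<close> form in auto)
      also have "\<dots> \<le> risk n f p \<mu> \<sigma> \<delta>'"
        using MRE \<open>equivariant \<delta>'\<close> \<open>0 < \<sigma>\<close> by (auto simp: MRE_def)
      finally show "risk n f p \<mu> \<sigma> (\<lambda>(x, s). x + s * d) \<le> risk n f p \<mu> \<sigma> \<delta>'" .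
    qed
    then have "\<forall>z\<in>sample_space. (\<lambda>(x, s). x + s * d) z = \<delta> z" using mre by (auto simp: unique_MRE_def)
    then have "(\<lambda>(x, s). x + s * d) (0, 1) = \<delta> (0, 1)" by (rule bspec) (simp add: sample_space_def)
    then show ?thesis by (simp add: c_def)
  qed
  have c0: "c = 0" using unique[of "- c"] by (simp add: J_minus)
  show "0 < s \<Longrightarrow> \<delta> (x, s) = x" using form c0 by simp
  show "d \<noteq> 0 \<Longrightarrow> J UNIV 0 < J UNIV d" using unique[of d] c0 by force
qed

text \<open>The normalized shift strictly minimizes \<open>J {..<x / s}\<close>, a function that
  involves the observation only through x / s, so it can be read off at s = 1.\<close>

lemma generalized_Bayes_eq:
  assumes bayes: "generalized_Bayes n f p \<pi>\<^sub>0 \<delta>"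
  obtains g where "\<And>x s. 0 < s \<Longrightarrow> \<delta> (x, s) = x + s * g (x / s)"
    and "\<And>t d. d \<noteq> g t \<Longrightarrow> J {..<t} (g t) < J {..<t} d"
proof -
  define h where "h x s = (\<delta> (x, s) - x) / s" for x s
  have h: "\<delta> (x, s) = x + s * h x s" if "0 < s" for x s
    using that by (simp add: h_def)
  have min: "J {..<x / s} (h x s) < J {..<x / s} d" if s: "0 < s" and d: "d \<noteq> h x s" for x s d
  proof -
    obtain K where K: "\<And>x c. posterior_risk n f p \<pi>\<^sub>0 (x, s) (x + s * c) = K * ennreal (J {..<x / s} c)"
      using posterior_risk_eq[OF s] by blast
    have "x + s * d \<noteq> \<delta> (x, s)" using s d h[OF s] by simp
    then have "posterior_risk n f p \<pi>\<^sub>0 (x, s) (\<delta> (x, s)) < posterior_risk n f p \<pi>\<^sub>0 (x, s) (x + s * d)"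
      using bayes s by (auto simp: generalized_Bayes_def sample_space_def)
    then have lt: "K * ennreal (J {..<x / s} (h x s)) < K * ennreal (J {..<x / s} d)"
      unfolding h[OF s] K .
    show ?thesis
    proof (rule ccontr)
      assume "\<not> ?thesis"
      then have "K * ennreal (J {..<x / s} d) \<le> K * ennreal (J {..<x / s} (h x s))"
        by (intro mult_left_mono ennreal_leI) auto
      then show False using lt by simp
    qed
  qed
  show ?thesis
  proof (rule that[of "\<lambda>t. h t 1"])
    show "J {..<t} (h t 1) < J {..<t} d" if "d \<noteq> h t 1" for t d using min[of 1 d t] that by simp
    show "\<delta> (x, s) = x + s * h (x / s) 1" if s: "0 < s" for x s
    proof -
      \<comment> \<open>Both shifts are strict minimizers of the same function; if they differed,
        each would beat the other.\<close>
      have "h x s = h (x / s) 1"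
        using min[OF s, of "h (x / s) 1" x] min[of 1 "h x s" "x / s"] by force
      then show ?thesis using h[OF s] by simp
    qed
  qed
qed

end

theorem theorem3:
  fixes n :: nat and f :: "real \<Rightarrow> real" and p :: real
    and \<delta>\<^sub>0 \<delta>\<^sub>\<pi> :: "real \<times> real \<Rightarrow> real"
  assumes "n \<ge> 1"
    and "0 < p" and "p < 1"
    and "\<And>t. t > 0 \<Longrightarrow> f t > 0"
    and "\<And>t. t > 0 \<Longrightarrow> f differentiable (at t)"
    and "\<And>t. t > 0 \<Longrightarrow> deriv f t < 0"
    and "antimono_on {0<..} (\<lambda>t. t * deriv f t / f t)"
    and "\<And>\<mu> \<sigma>. \<sigma> > 0 \<Longrightarrow> prob_space (model n f \<mu> \<sigma>)"
    and "unique_MRE n f p \<delta>\<^sub>0"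
    and "\<And>\<mu> \<sigma>. \<sigma> > 0 \<Longrightarrow> risk n f p \<mu> \<sigma> \<delta>\<^sub>0 < \<infinity>"
    and "generalized_Bayes n f p \<pi>\<^sub>0 \<delta>\<^sub>\<pi>"
  shows "minimax n f p \<delta>\<^sub>0 \<delta>\<^sub>\<pi>"
proof -
  have "continuous_on {0<..} f"
    using assms(5) by (intro continuous_at_imp_continuous_on ballI differentiable_imp_continuous_within) auto
  then interpret location_scale n f p using assms(1-4) by unfold_locales auto
  obtain g where g: "\<And>x s. 0 < s \<Longrightarrow> \<delta>\<^sub>\<pi> (x, s) = x + s * g (x / s)"
    and g_min: "\<And>t d. d \<noteq> g t \<Longrightarrow> J {..<t} (g t) < J {..<t} d"
    using generalized_Bayes_eq[OF assms(11)] by blast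
  note MRE = unique_MRE_eq[OF assms(9)]
  interpret bayes_shift p "(real n + p + 1) / 2" g
    using g_min MRE(2) by unfold_locales auto
  \<comment> \<open>The finite risk of \<open>\<delta>\<^sub>0\<close> factors into
    \<open>tail 0\<close> and a positive number, so \<open>tail 0\<close> is finite.\<close>
  have "tail 0 * ennreal (J UNIV 0) < \<infinity>"
    using risk_affine[of 1 \<delta>\<^sub>0 0 0] MRE(1) assms(10)[of 1 0] by simp
  then have fin: "tail 0 < \<infinity>" using J_UNIV_pos[of 0] by (auto simp: ennreal_mult_less_top)
  have "risk n f p \<mu> \<sigma> \<delta>\<^sub>\<pi> \<le> risk n f p \<mu> \<sigma> \<delta>\<^sub>0" if "0 \<le> \<mu>" "0 < \<sigma>" for \<mu> \<sigma>
  proof -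
    have "risk n f p \<mu> \<sigma> \<delta>\<^sub>\<pi>
      = (\<integral>\<^sup>+v. \<integral>\<^sup>+w. ennreal (weight v w) * ennreal (\<bar>w + g (w + \<mu> / \<sigma> / v)\<bar> powr p) \<partial>lborel \<partial>lborel)"
      by (rule risk_eq[OF \<open>0 < \<sigma>\<close> measurable_g g])
    also have "\<dots> \<le> (\<integral>\<^sup>+v. \<integral>\<^sup>+w. ennreal (weight v w) * ennreal (\<bar>w + 0\<bar> powr p) \<partial>lborel \<partial>lborel)"
      using that fin by (intro risk_integral_le bayes_shift_axioms) auto
    \<comment> \<open>\<open>\<delta>\<^sub>0\<close> corresponds to the shift function that is
      identically 0.\<close>
    also have "\<dots> = risk n f p \<mu> \<sigma> \<delta>\<^sub>0"
      by (rule risk_eq[OF \<open>0 < \<sigma>\<close>, of "\<lambda>_. 0", symmetric]) (use MRE(1) in auto)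
    finally show ?thesis .
  qed
  then show ?thesis using assms(11) by (auto simp: minimax_def generalized_Bayes_def)
qed

end
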